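(* For all $n\ge2$, $0\le k\le n-2$, all subsets $J\subset[1,k]$ with $J=k+1-J$ and all subsets $K\subset[n+k+2,2n-1]$ with $K=3n+k+1-K$, the assignments $$\widehat T_1\mapsto T_{w_\circ^{[1,n+k]\cup K}},\qquad\widehat T_2\mapsto T_{w_\circ^{[k+2,2n-1]\cup J}}$$ define a homomorphism $\mathrm{Br}^+(B_2)\to\mathrm{Br}^+_{2n}$.
   Context: $\mathrm{Br}^+_{k}$ is the braid monoid on $k$ strands: generators $T_1,\dots,T_{k-1}$, relations $T_iT_{i+1}T_i=T_{i+1}T_iT_{i+1}$ and $T_iT_j=T_jT_i$ for $|i-j|>1$. $\mathrm{Br}^+(B_2)$ has generators $\widehat T_1,\widehat T_2$ and the single relation $\widehat T_1\widehat T_2\widehat T_1\widehat T_2=\widehat T_2\widehat T_1\widehat T_2\widehat T_1$. For integers $a\le b$, $[a,b]=\{a,\dots,b\}$, and $[a,b]=\emptyset$ if $a>b$; $c-K=\{c-k:k\in K\}$. For $w\in S_k$ with reduced expression $w=s_{i_1}\cdots s_{i_r}$ in simple transpositions, $T_w=T_{i_1}\cdots T_{i_r}$. For $L\subset[1,k-1]$, $w_\circ^L$ is the longest element of the parabolic subgroup of $S_k$ generated by $s_l$, $l\in L$. *)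

theory Defs
  imports "HOL-Algebra.Algebra"
begin

section \<open>Monoids given by generators and relations\<close>

inductive_set pres_cong :: "'g set \<Rightarrow> ('g list \<times> 'g list) set \<Rightarrow> ('g list \<times> 'g list) set"
  for S :: "'g set" and R :: "('g list \<times> 'g list) set"
where
  refl: "u \<in> lists S \<Longrightarrow> (u, u) \<in> pres_cong S R"
| rel: "(l, r) \<in> R \<Longrightarrow> l \<in> lists S \<Longrightarrow> r \<in> lists S \<Longrightarrow> x \<in> lists S \<Longrightarrow> y \<in> lists S
    \<Longrightarrow> (x @ l @ y, x @ r @ y) \<in> pres_cong S R"
| sym: "(u, v) \<in> pres_cong S R \<Longrightarrow> (v, u) \<in> pres_cong S R"
| trans: "(u, v) \<in> pres_cong S R \<Longrightarrow> (v, w) \<in> pres_cong S R \<Longrightarrow> (u, w) \<in> pres_cong S R"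

definition pres_class :: "'g set \<Rightarrow> ('g list \<times> 'g list) set \<Rightarrow> 'g list \<Rightarrow> 'g list set" where
  "pres_class S R u = pres_cong S R `` {u}"

definition pres_monoid :: "'g set \<Rightarrow> ('g list \<times> 'g list) set \<Rightarrow> 'g list set monoid" where
  "pres_monoid S R =
    \<lparr> carrier = lists S // pres_cong S R,
      monoid.mult = (\<lambda>A B. \<Union>a\<in>A. \<Union>b\<in>B. pres_class S R (a @ b)),
      one = pres_class S R [] \<rparr>"

definition pres_gen :: "'g set \<Rightarrow> ('g list \<times> 'g list) set \<Rightarrow> 'g \<Rightarrow> 'g list set" where
  "pres_gen S R a = pres_class S R [a]"

definition word_prod :: "('a, 'b) monoid_scheme \<Rightarrow> 'a list \<Rightarrow> 'a" where
  "word_prod G xs = foldr (\<lambda>x y. x \<otimes>\<^bsub>G\<^esub> y) xs \<one>\<^bsub>G\<^esub>"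

lemma pres_cong_lists: "(u, v) \<in> pres_cong S R \<Longrightarrow> u \<in> lists S \<and> v \<in> lists S"
  by (induction rule: pres_cong.induct) auto

lemma equiv_pres_cong: "equiv (lists S) (pres_cong S R)"
proof (rule equivI)
  show "pres_cong S R \<subseteq> lists S \<times> lists S"
    by (auto dest: pres_cong_lists)
  show "refl_on (lists S) (pres_cong S R)"
    by (rule refl_onI) (rule pres_cong.refl)
  show "sym (pres_cong S R)"
    by (rule symI) (rule pres_cong.sym)
  show "trans (pres_cong S R)"
    by (rule transI) (rule pres_cong.trans)
qed

lemma pres_cong_context:
  "(u, v) \<in> pres_cong S R \<Longrightarrow> x \<in> lists S \<Longrightarrow> y \<in> lists S
    \<Longrightarrow> (x @ u @ y, x @ v @ y) \<in> pres_cong S R"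
proof (induction rule: pres_cong.induct)
  case (refl u)
  then show ?case by (auto intro!: pres_cong.refl)
next
  case (rel l r a b)
  then show ?case using pres_cong.rel[of l r R S "x @ a" "b @ y"] by simp
next
  case (sym u v)
  then show ?case by (metis pres_cong.sym)
next
  case (trans u v w)
  then show ?case by (metis pres_cong.trans)
qed

lemma pres_cong_append:
  assumes "(u, u') \<in> pres_cong S R" "(v, v') \<in> pres_cong S R"
  shows "(u @ v, u' @ v') \<in> pres_cong S R"
  using pres_cong_context[OF assms(1), of "[]" v] pres_cong_context[OF assms(2), of u' "[]"]
    pres_cong_lists[OF assms(1)] pres_cong_lists[OF assms(2)]
  by (metis append_Nil append_Nil2 lists.Nil pres_cong.trans)

lemma pres_class_eq_iff:
  "u \<in> lists S \<Longrightarrow> v \<in> lists S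
    \<Longrightarrow> pres_class S R u = pres_class S R v \<longleftrightarrow> (u, v) \<in> pres_cong S R"
  unfolding pres_class_def by (rule eq_equiv_class_iff[OF equiv_pres_cong])

lemma pres_carrier: "carrier (pres_monoid S R) = pres_class S R ` lists S"
  by (auto simp: pres_monoid_def quotient_def pres_class_def)

lemma pres_one: "\<one>\<^bsub>pres_monoid S R\<^esub> = pres_class S R []"
  by (simp add: pres_monoid_def)

lemma pres_mult:
  assumes "u \<in> lists S" "v \<in> lists S"
  shows "pres_class S R u \<otimes>\<^bsub>pres_monoid S R\<^esub> pres_class S R v = pres_class S R (u @ v)"
proof -
  have eq: "pres_class S R (a @ b) = pres_class S R (u @ v)"
    if "(u, a) \<in> pres_cong S R" "(v, b) \<in> pres_cong S R" for a b
    using pres_cong_append[OF that] equiv_class_eq[OF equiv_pres_cong]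
    unfolding pres_class_def by blast
  have "(u, u) \<in> pres_cong S R" "(v, v) \<in> pres_cong S R"
    by (rule pres_cong.refl, fact)+
  then have ne: "pres_cong S R `` {u} \<noteq> {}" "pres_cong S R `` {v} \<noteq> {}"
    by blast+
  have "pres_class S R u \<otimes>\<^bsub>pres_monoid S R\<^esub> pres_class S R v =
      (\<Union>a\<in>pres_cong S R `` {u}. \<Union>b\<in>pres_cong S R `` {v}. pres_class S R (a @ b))"
    by (simp only: pres_monoid_def monoid.simps pres_class_def)
  also have "\<dots> = (\<Union>a\<in>pres_cong S R `` {u}. \<Union>b\<in>pres_cong S R `` {v}. pres_class S R (u @ v))"
    by (intro SUP_cong HOL.refl eq) blast+
  also have "\<dots> = pres_class S R (u @ v)"
    using ne by simp
  finally show ?thesis .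
qed

lemma monoid_pres_monoid: "monoid (pres_monoid S R)"
proof (rule monoidI; (unfold pres_carrier pres_one)?; (elim imageE)?; hypsubst?)
  show "pres_class S R [] \<in> pres_class S R ` lists S"
    by simp
next
  fix u v assume uv: "u \<in> lists S" "v \<in> lists S"
  then have "u @ v \<in> lists S" by simp
  then show "pres_class S R u \<otimes>\<^bsub>pres_monoid S R\<^esub> pres_class S R v \<in> pres_class S R ` lists S"
    unfolding pres_mult[OF uv] by (rule imageI)
next
  fix u v w assume uvw: "u \<in> lists S" "v \<in> lists S" "w \<in> lists S"
  then have "u @ v \<in> lists S" "v @ w \<in> lists S" by simp_all
  with uvw show "pres_class S R u \<otimes>\<^bsub>pres_monoid S R\<^esub> pres_class S R v
      \<otimes>\<^bsub>pres_monoid S R\<^esub> pres_class S R w =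
    pres_class S R u \<otimes>\<^bsub>pres_monoid S R\<^esub>
      (pres_class S R v \<otimes>\<^bsub>pres_monoid S R\<^esub> pres_class S R w)"
    by (metis pres_mult append_assoc)
next
  fix u assume u: "u \<in> lists S"
  then show "pres_class S R [] \<otimes>\<^bsub>pres_monoid S R\<^esub> pres_class S R u = pres_class S R u"
    by (metis pres_mult lists.Nil append_Nil)
  show "pres_class S R u \<otimes>\<^bsub>pres_monoid S R\<^esub> pres_class S R [] = pres_class S R u"
    using u by (metis pres_mult lists.Nil append_Nil2)
qed

lemma pres_class_eq_word_prod:
  "ws \<in> lists S \<Longrightarrow> pres_class S R ws = word_prod (pres_monoid S R) (map (pres_gen S R) ws)"
proof (induction ws)
  case Nil
  then show ?case by (simp add: word_prod_def pres_one)
next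
  case (Cons a ws)
  then have "pres_class S R (a # ws) =
      pres_gen S R a \<otimes>\<^bsub>pres_monoid S R\<^esub> pres_class S R ws"
    using pres_mult[of "[a]" S ws R] by (simp add: pres_gen_def)
  with Cons show ?case by (simp add: word_prod_def)
qed


section \<open>The braid monoids\<close>

definition braid_rels :: "nat \<Rightarrow> (nat list \<times> nat list) set" where
  "braid_rels k =
    {([i, i + 1, i], [i + 1, i, i + 1]) | i. i \<in> {1..<k} \<and> i + 1 \<in> {1..<k}} \<union>
    {([i, j], [j, i]) | i j. i \<in> {1..<k} \<and> j \<in> {1..<k} \<and> \<bar>int i - int j\<bar> > 1}"

definition braid_monoid :: "nat \<Rightarrow> nat list set monoid" where
  "braid_monoid k = pres_monoid {1..<k} (braid_rels k)"

definition braid_gen :: "nat \<Rightarrow> nat \<Rightarrow> nat list set" where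
  "braid_gen k i = pres_gen {1..<k} (braid_rels k) i"

definition B2_rels :: "(nat list \<times> nat list) set" where
  "B2_rels = {([1, 2, 1, 2], [2, 1, 2, 1])}"

definition braid_monoid_B2 :: "nat list set monoid" where
  "braid_monoid_B2 = pres_monoid {1, 2} B2_rels"

definition B2_gen :: "nat \<Rightarrow> nat list set" where
  "B2_gen i = pres_gen {1, 2} B2_rels i"


section \<open>Symmetric groups, reduced expressions and longest elements\<close>

definition simple_transp :: "nat \<Rightarrow> nat \<Rightarrow> nat" where
  "simple_transp i = transpose i (i + 1)"

definition expressions :: "nat \<Rightarrow> (nat \<Rightarrow> nat) \<Rightarrow> nat list set" where
  "expressions k w = {ws \<in> lists {1..<k}. word_prod (sym_group k) (map simple_transp ws) = w}"

definition perm_length :: "nat \<Rightarrow> (nat \<Rightarrow> nat) \<Rightarrow> nat" where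
  "perm_length k w = (LEAST r. \<exists>ws \<in> expressions k w. length ws = r)"

definition reduced_expressions :: "nat \<Rightarrow> (nat \<Rightarrow> nat) \<Rightarrow> nat list set" where
  "reduced_expressions k w = {ws \<in> expressions k w. length ws = perm_length k w}"

text \<open>The element \<open>T\<^sub>w\<close>. By Matsumoto's theorem it does not depend on the reduced
  expression that is chosen.\<close>

definition braid_lift :: "nat \<Rightarrow> (nat \<Rightarrow> nat) \<Rightarrow> nat list set" where
  "braid_lift k w =
    word_prod (braid_monoid k) (map (braid_gen k) (SOME ws. ws \<in> reduced_expressions k w))"

definition parabolic :: "nat \<Rightarrow> nat set \<Rightarrow> (nat \<Rightarrow> nat) set" where
  "parabolic k L = generate (sym_group k) (simple_transp ` L)"

text \<open>The length on \<open>S\<^sub>k\<close> restricts to the length of the parabolic subgroup with respect to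
  its own simple transpositions, and the maximum is attained exactly once.\<close>

definition longest_elt :: "nat \<Rightarrow> nat set \<Rightarrow> (nat \<Rightarrow> nat)" where
  "longest_elt k L = (ARG_MAX (perm_length k) w. w \<in> parabolic k L)"

end

theory Submission
  imports Defs
begin

text \<open>Put \<open>p = k + 1\<close> and \<open>q = n - p\<close>, and cut the \<open>2n\<close> strands into consecutive cables of
  \<open>p, q, p, q\<close> strands. Up to twists inside the cables, \<open>A = T\<^sub>w\<close> for \<open>w\<close> the longest element of
  \<open>[1,n+k] \<union> K\<close> is the half twist of the first three cables, and \<open>B\<close> is that of the last three.

  Let \<open>Z\<close> be the positive braid that moves the first \<open>n\<close> strands across the last \<open>n\<close>, and write
  \<open>u'\<close> for a braid \<open>u\<close> on the first \<open>n\<close> strands shifted to the last \<open>n\<close>; then \<open>Z u = u' Z\<close> and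
  \<open>Z u' = u Z\<close>. Let \<open>Y\<close> be the half twist of the first \<open>n\<close> strands, \<open>P\<close> and \<open>Q\<close> those of the
  first two cables, \<open>J\<close> the lift of the longest element of the set \<open>J\<close> and \<open>K'\<close> that of \<open>K\<close>. Splitting
  off block swaps gives \<open>A = Y P' K' Z\<^sub>1 = Z\<^sub>4 Y P' K'\<close> and \<open>B = Z\<^sub>2 Y' Q J = Y' Q J Z\<^sub>3\<close> with
  \<open>Z\<^sub>1 Z\<^sub>2 = Z\<^sub>3 Z\<^sub>4 = Z\<close>, hence \<open>AB = Y Y P'K'Q'J' Z\<close> and \<open>BA = Y'Y' P K Q J Z\<close>. The prefixes
  are exchanged by \<open>Z\<close>, and they commute: \<open>Y Y\<close> is central on its \<open>n\<close> strands, and the symmetry of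
  the sets \<open>J\<close> and \<open>K\<close> makes \<open>J\<close> commute with \<open>P\<close> and \<open>K\<close> with \<open>Q\<close>. So \<open>ABAB = BABA\<close>.

  Identities between lifted permutations follow from \<open>T\<^sub>u T\<^sub>v = T\<^bsub>u \<circ> v\<^esub>\<close>, valid when no inversion
  of \<open>v\<close> is undone by \<open>u\<close>.\<close>


section \<open>Inversions\<close>

text \<open>Pairs of positions, not of values: the inversions of \<open>v\<close> and of
  \<open>u \<circ> v\<close> can then be compared without relabelling.\<close>

definition inversions :: "(nat \<Rightarrow> nat) \<Rightarrow> (nat \<times> nat) set" where
  "inversions w = {(a, b). a < b \<and> w b < w a}"

lemma inversions_subset:
  fixes w :: "nat \<Rightarrow> nat"
  assumes w: "w permutes {1..N}"
  shows "inversions w \<subseteq> {(a, b). a < b \<and> 1 \<le> a \<and> b \<le> N}"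
proof clarify
  fix a b assume "(a, b) \<in> inversions w"
  then have ab: "a < b" "w b < w a" by (auto simp: inversions_def)
  have out: "w t = t" if "t = 0 \<or> N < t" for t
    using that by (intro permutes_not_in[OF w]) auto
  have "a \<noteq> 0" using out[of a] ab by (metis not_less0)
  moreover have "b \<le> N"
  proof (rule ccontr)
    assume b: "\<not> b \<le> N"
    then have "N < w a" using out[of b] ab by linarith
    then have "w (w a) = w a" using out by blast
    then have "w a = a" using inj_eq[OF permutes_inj[OF w]] by simp
    then show False using out[of b] b ab by linarith
  qed
  ultimately show "a < b \<and> 1 \<le> a \<and> b \<le> N" using ab by auto
qed

lemma finite_inversions:
  assumes "w permutes {1..N}" shows "finite (inversions w)"
  by (rule finite_subset[of _ "{1..N} \<times> {1..N}"]) (use inversions_subset[OF assms] in auto)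

text \<open>Without inversions \<open>w\<close> is strictly increasing, and so is its inverse.
  Neither can move a point down, so no point moves.\<close>

lemma inversions_empty_imp_id:
  assumes w: "w permutes {1..N}" and "inversions w = {}"
  shows "w = id"
proof -
  have "w a < w b" if "a < b" for a b
    using that assms(2) permutes_inj[OF w] by (auto simp: inversions_def inj_def) (metis linorder_neqE_nat nat_neq_iff)
  then have m: "strict_mono w" by (simp add: strict_mono_def)
  have "strict_mono (inv' w)"
    using m permutes_inverses[OF w] by (metis linorder_not_le strict_mono_def strict_mono_less_eq)
  then have "x \<le> inv' w x" "x \<le> w x" for x using m strict_mono_imp_increasing by blast+
  then have "w x = x" for x
    using m permutes_inverses(2)[OF w] by (metis order_antisym)
  then show ?thesis by (simp add: fun_eq_iff)
qed

lemma ex_descent: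
  fixes w :: "nat \<Rightarrow> nat"
  assumes w: "w permutes {1..N}" and "w \<noteq> id"
  obtains i where "i \<in> {1..<N}" "w (i + 1) < w i"
proof -
  have "\<exists>i. w (Suc i) < w i"
  proof (rule ccontr)
    assume "\<not> ?thesis"
    then have "w i \<le> w (Suc i)" for i by (simp add: not_less)
    then have "w a \<le> w b" if "a < b" for a b using lift_Suc_mono_le[of w a b] that by simp
    then have "\<not> (a < b \<and> w b < w a)" for a b by (metis linorder_not_le)
    then have "inversions w = {}" by (simp add: inversions_def)
    then show False using assms(2) inversions_empty_imp_id[OF w] by blast
  qed
  then obtain i where i: "w (Suc i) < w i" by blast
  then have "(i, Suc i) \<in> inversions w" by (simp add: inversions_def)
  with inversions_subset[OF w] have "i \<in> {1..<N}" by auto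
  with i that[of i] show ?thesis by simp
qed

text \<open>The hypothesis says that no inversion of \<open>v\<close> is undone by \<open>u\<close>, so the inversions of
  \<open>u\<close>, transported along \<open>v\<close>, are exactly the new ones.\<close>

lemma card_inversions_comp:
  assumes u: "u permutes {1..N}" and v: "v permutes {1..N}"
    and sub: "inversions v \<subseteq> inversions (u \<circ> v)"
  shows "card (inversions (u \<circ> v)) = card (inversions u) + card (inversions v)"
proof -
  have iv: "inv' v (v t) = t" "v (inv' v t) = t" for t using permutes_inverses[OF v] by auto
  have "bij_betw (\<lambda>(a, b). (v a, v b)) (inversions (u \<circ> v) - inversions v) (inversions u)"
  proof (rule bij_betwI[where g = "\<lambda>(a, b). (inv' v a, inv' v b)"])
    show "(\<lambda>(a, b). (v a, v b)) \<in> inversions (u \<circ> v) - inversions v \<rightarrow> inversions u"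
      using permutes_inj[OF v] by (auto simp: inversions_def inj_def) (metis nat_neq_iff)
    show "(\<lambda>(a, b). (inv' v a, inv' v b)) \<in> inversions u \<rightarrow> inversions (u \<circ> v) - inversions v"
    proof clarify
      fix c d assume cd: "(c, d) \<in> inversions u"
      have ne: "inv' v c \<noteq> inv' v d" using cd iv by (metis (mono_tags, lifting) case_prodD inversions_def mem_Collect_eq nat_neq_iff)
      \<comment> \<open>Here \<open>sub\<close> enters: a pair whose order is reversed by
        \<open>inv' v\<close> comes from an inversion of \<open>v\<close>, and \<open>u\<close>,
        which inverts \<open>(c, d)\<close>, would undo it.\<close>
      have "\<not> inv' v d < inv' v c"
      proof
        assume "inv' v d < inv' v c"
        then have "(inv' v d, inv' v c) \<in> inversions v" using cd by (auto simp: inversions_def iv)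
        then have "(inv' v d, inv' v c) \<in> inversions (u \<circ> v)" using sub by blast
        with cd show False by (auto simp: inversions_def iv)
      qed
      with ne cd show "(inv' v c, inv' v d) \<in> inversions (u \<circ> v) - inversions v"
        by (auto simp: inversions_def iv)
    qed
  qed (auto simp: iv)
  then have "card (inversions (u \<circ> v) - inversions v) = card (inversions u)"
    by (rule bij_betw_same_card)
  moreover have "finite (inversions (u \<circ> v))"
    using finite_inversions permutes_compose[OF v u] by blast
  ultimately show ?thesis
    using sub by (metis add.commute card_Diff_subset card_mono finite_subset le_add_diff_inverse)
qed

text \<open>Factor \<open>u\<close> as \<open>(u \<circ> inv' v) \<circ> v\<close>. Equal inversion
  sets make the numbers of inversions add, which leaves none for the left factor.\<close>

lemma inversions_inj:
  assumes u: "u permutes {1..N}" and v: "v permutes {1..N}" and "inversions u = inversions v"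
  shows "u = v"
proof -
  have iv: "inv' v (v t) = t" "v (inv' v t) = t" for t using permutes_inverses[OF v] by auto
  have "card (inversions (u \<circ> inv' v \<circ> v)) = card (inversions (u \<circ> inv' v)) + card (inversions v)"
    by (rule card_inversions_comp[OF permutes_compose[OF permutes_inv[OF v] u] v])
      (use assms(3) in \<open>simp add: o_assoc[symmetric] permutes_inv_o[OF v]\<close>)
  then have "card (inversions (u \<circ> inv' v)) = 0"
    using assms(3) by (simp add: o_assoc[symmetric] permutes_inv_o[OF v])
  then have "inversions (u \<circ> inv' v) = {}"
    using finite_inversions[OF permutes_compose[OF permutes_inv[OF v] u]] by simp
  then have "u \<circ> inv' v = id"
    by (rule inversions_empty_imp_id[OF permutes_compose[OF permutes_inv[OF v] u]])
  then have "(u \<circ> inv' v) (v t) = v t" for t by simp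
  then show ?thesis by (simp add: fun_eq_iff iv)
qed


section \<open>Length in the symmetric group\<close>

text \<open>The product in \<open>sym_group N\<close>, written as plain composition so that it does
  not mention \<open>N\<close>.\<close>

definition perm_of_word :: "nat list \<Rightarrow> nat \<Rightarrow> nat" where
  "perm_of_word ws = foldr (\<circ>) (map simple_transp ws) id"

lemma perm_of_word_simps [simp]:
  "perm_of_word [] = id"
  "perm_of_word (i # ws) = simple_transp i \<circ> perm_of_word ws"
  by (simp_all add: perm_of_word_def)

lemma perm_of_word_append [simp]: "perm_of_word (us @ vs) = perm_of_word us \<circ> perm_of_word vs"
  by (induction us) (simp_all add: o_assoc)

lemma word_prod_sym_group: "word_prod (sym_group N) (map simple_transp ws) = perm_of_word ws"
  by (simp add: word_prod_def perm_of_word_def sym_group_def)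

lemma expressions_iff: "ws \<in> expressions N w \<longleftrightarrow> ws \<in> lists {1..<N} \<and> perm_of_word ws = w"
  by (simp add: expressions_def word_prod_sym_group)

lemma inversions_id [simp]: "inversions id = {}"
  by (auto simp: inversions_def)

lemma simple_transp_permutes: "i \<in> {1..<N} \<Longrightarrow> simple_transp i permutes {1..N}"
  by (auto simp: simple_transp_def intro!: permutes_swap_id)

lemma simple_transp_invol [simp]: "simple_transp i (simple_transp i t) = t"
  by (simp add: simple_transp_def)

lemma simple_transp_comp_self [simp]: "simple_transp i \<circ> simple_transp i = id"
  by (simp add: fun_eq_iff)

lemma simple_transp_self [simp]:
  "simple_transp i i = i + 1" "simple_transp i (Suc i) = i"
  by (simp_all add: simple_transp_def)

lemma inversions_simple_transp: "inversions (simple_transp i) = {(i, i + 1)}"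
  by (auto simp: inversions_def simple_transp_def transpose_def split: if_splits)

lemma perm_of_word_permutes: "ws \<in> lists {1..<N} \<Longrightarrow> perm_of_word ws permutes {1..N}"
proof (induction ws)
  case Nil
  show "perm_of_word [] permutes {1..N}" by (simp add: permutes_id)
next
  case (Cons i ws)
  then show "perm_of_word (i # ws) permutes {1..N}"
    using permutes_compose[OF _ simple_transp_permutes[of i N]] by simp
qed

text \<open>The only inversion of \<open>simple_transp i\<close> is \<open>(i, i + 1)\<close>, and
  at an ascent \<open>w\<close> does not undo it, so the counts add.\<close>

lemma card_inversions_ascent:
  assumes "w permutes {1..N}" "i \<in> {1..<N}" "w i < w (i + 1)"
  shows "card (inversions (w \<circ> simple_transp i)) = card (inversions w) + 1"
  using card_inversions_comp[OF assms(1) simple_transp_permutes[OF assms(2)]] assms(3)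
  unfolding inversions_simple_transp by (simp add: inversions_def)

lemma card_inversions_descent:
  assumes "w permutes {1..N}" "i \<in> {1..<N}" "w (i + 1) < w i"
  shows "card (inversions w) = card (inversions (w \<circ> simple_transp i)) + 1"
  using card_inversions_ascent[OF permutes_compose[OF simple_transp_permutes[OF assms(2)] assms(1)] assms(2)]
    assms(3) by (simp add: o_assoc[symmetric])

text \<open>Each further letter changes the number of inversions by one, up or down.\<close>

lemma card_inversions_le_length:
  "ws \<in> lists {1..<N} \<Longrightarrow> card (inversions (perm_of_word ws)) \<le> length ws"
proof (induction ws rule: rev_induct)
  case Nil
  show "card (inversions (perm_of_word [])) \<le> length []" by simp
next
  case (snoc i ws)
  let ?w = "perm_of_word ws"
  have w: "?w permutes {1..N}" and i: "i \<in> {1..<N}" using snoc.prems perm_of_word_permutes by auto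
  have "?w i \<noteq> ?w (i + 1)" using inj_eq[OF permutes_inj[OF w]] by simp
  then have "?w i < ?w (i + 1) \<or> ?w (i + 1) < ?w i" by linarith
  then have "card (inversions (?w \<circ> simple_transp i)) \<le> card (inversions ?w) + 1"
    using card_inversions_ascent[OF w i] card_inversions_descent[OF w i] by linarith
  moreover have "card (inversions ?w) \<le> length ws" using snoc by simp
  ultimately show "card (inversions (perm_of_word (ws @ [i]))) \<le> length (ws @ [i])" by simp
qed

text \<open>Bubble sort: multiplying by a descent removes exactly one inversion, so the lower bound
  for the length of a word is attained.\<close>

lemma ex_word_length_inversions:
  assumes "w permutes {1..N}"
  shows "\<exists>ws \<in> lists {1..<N}. perm_of_word ws = w \<and> length ws = card (inversions w)"
  using assms
proof (induction "card (inversions w)" arbitrary: w rule: less_induct)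
  case less
  show ?case
  proof (cases "w = id")
    case True then show ?thesis by (intro bexI[of _ "[]"]) auto
  next
    case False
    then obtain i where i: "i \<in> {1..<N}" "w (i + 1) < w i" using ex_descent less.prems by blast
    let ?v = "w \<circ> simple_transp i"
    have c: "card (inversions w) = card (inversions ?v) + 1" using card_inversions_descent[OF less.prems i] .
    obtain ws where "ws \<in> lists {1..<N}" "perm_of_word ws = ?v" "length ws = card (inversions ?v)"
      using less.hyps[of ?v] c permutes_compose[OF simple_transp_permutes[OF i(1)] less.prems] by auto
    then show ?thesis using c i
      by (intro bexI[of _ "ws @ [i]"]) (auto simp: o_assoc[symmetric])
  qed
qed

lemma perm_length_eq:
  assumes "w permutes {1..N}"
  shows "perm_length N w = card (inversions w)"
  unfolding perm_length_def
proof (rule Least_equality)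
  show "\<exists>ws\<in>expressions N w. length ws = card (inversions w)"
    using ex_word_length_inversions[OF assms] by (metis expressions_iff)
  show "card (inversions w) \<le> r" if "\<exists>ws\<in>expressions N w. length ws = r" for r
  proof -
    from that obtain ws where "ws \<in> expressions N w" "length ws = r" by blast
    then show ?thesis using card_inversions_le_length[of ws N] by (simp add: expressions_iff)
  qed
qed

lemma reduced_expressions_iff:
  assumes "w permutes {1..N}"
  shows "ws \<in> reduced_expressions N w \<longleftrightarrow>
    ws \<in> lists {1..<N} \<and> perm_of_word ws = w \<and> length ws = card (inversions w)"
  unfolding reduced_expressions_def expressions_iff perm_length_eq[OF assms] by blast


section \<open>Reduced words are braid equivalent\<close>

abbreviation braid_cong :: "nat \<Rightarrow> (nat list \<times> nat list) set" where
  "braid_cong N \<equiv> pres_cong {1..<N} (braid_rels N)"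

lemma braid_cong_refl: "u \<in> lists {1..<N} \<Longrightarrow> (u, u) \<in> braid_cong N"
  by (rule pres_cong.refl)

lemma simple_transp_braid:
  "simple_transp i \<circ> (simple_transp (Suc i) \<circ> simple_transp i) =
   simple_transp (Suc i) \<circ> (simple_transp i \<circ> simple_transp (Suc i))"
  by (auto simp: fun_eq_iff simple_transp_def transpose_def)

lemma simple_transp_commute:
  "\<bar>int i - int j\<bar> > 1 \<Longrightarrow> simple_transp i \<circ> simple_transp j = simple_transp j \<circ> simple_transp i"
  by (auto simp: fun_eq_iff simple_transp_def transpose_def)

text \<open>Both kinds of relation are homogeneous and hold in the symmetric group.\<close>

lemma braid_cong_invariants:
  "(u, v) \<in> braid_cong N \<Longrightarrow> perm_of_word u = perm_of_word v \<and> length u = length v"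
proof (induction rule: pres_cong.induct)
  case (rel l r x y)
  have "perm_of_word l = perm_of_word r \<and> length l = length r"
    using rel.hyps(1) simple_transp_braid simple_transp_commute
    unfolding braid_rels_def by fastforce
  then show ?case by simp
qed simp_all

lemma braid_cong_commute:
  assumes "i \<in> {1..<N}" "us \<in> lists {1..<N}" "\<And>j. j \<in> set us \<Longrightarrow> \<bar>int i - int j\<bar> > 1"
  shows "(us @ [i], i # us) \<in> braid_cong N"
  using assms(2,3)
proof (induction us rule: list.induct)
  case Nil
  show "([] @ [i], [i]) \<in> braid_cong N" using assms(1) by (simp add: pres_cong.refl)
next
  case (Cons j us)
  have j: "j \<in> {1..<N}" "us \<in> lists {1..<N}" using Cons.prems(1) by auto
  have "(us @ [i], i # us) \<in> braid_cong N" using Cons by simp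
  then have "([j] @ (us @ [i]) @ [], [j] @ (i # us) @ []) \<in> braid_cong N"
    by (rule pres_cong_context) (use j in auto)
  moreover have "([j, i], [i, j]) \<in> braid_rels N"
    using j(1) assms(1) Cons.prems(2)[of j] unfolding braid_rels_def by force
  then have "([] @ [j, i] @ us, [] @ [i, j] @ us) \<in> braid_cong N"
    by (rule pres_cong.rel) (use j assms(1) in auto)
  ultimately show ?case by (auto intro: pres_cong.trans)
qed

lemma braid_cong_contextI:
  assumes "(u, v) \<in> braid_cong N" "x \<in> lists {1..<N}" "y \<in> lists {1..<N}" "a = x @ u @ y" "b = x @ v @ y"
  shows "(a, b) \<in> braid_cong N"
  using pres_cong_context[OF assms(1-3)] assms(4,5) by simp

section \<open>Descending runs, normal words and squares\<close>

abbreviation desc_run :: "nat \<Rightarrow> nat \<Rightarrow> nat list" where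
  "desc_run j k \<equiv> rev [j..<k]"

text \<open>The letter commutes to the left past the entries below \<open>i - 1\<close> until it
  meets \<open>i, i - 1\<close>. The braid relation then turns \<open>i, i - 1, i\<close> into
  \<open>i - 1, i, i - 1\<close>, and the first of these letters commutes past the entries above
  \<open>i\<close>.\<close>

lemma desc_run_slide:
  assumes "1 \<le> j" "j < i" "i < k" "k \<le> N"
  shows "(desc_run j k @ [i], (i - 1) # desc_run j k) \<in> braid_cong N"
proof -
  obtain h where h: "i = Suc h" using assms by (cases i) auto
  have split: "desc_run j k = desc_run (Suc i) k @ [i, h] @ desc_run j h"
    using assms h upt_add_eq_append[of j h "k - h"] by (simp add: upt_conv_Cons)
  let ?A = "desc_run (Suc i) k" and ?B = "desc_run j h"
  have m: "?A \<in> lists {1..<N}" "?B \<in> lists {1..<N}" "i \<in> {1..<N}" "h \<in> {1..<N}"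
    using assms h by auto
  have "(?B @ [i], i # ?B) \<in> braid_cong N"
    by (rule braid_cong_commute) (use assms h m in auto)
  then have 1: "(?A @ [i, h] @ ?B @ [i], ?A @ [i, h, i] @ ?B) \<in> braid_cong N"
    by (rule braid_cong_contextI[of _ _ _ "?A @ [i, h]" "[]"]) (use m in auto)
  have "([h, i, h], [i, h, i]) \<in> braid_rels N"
    using m h unfolding braid_rels_def by auto
  then have "([] @ [h, i, h] @ [], [] @ [i, h, i] @ []) \<in> braid_cong N"
    by (rule pres_cong.rel) (use m in auto)
  then have "([i, h, i], [h, i, h]) \<in> braid_cong N"
    by (auto intro: pres_cong.sym)
  then have 2: "(?A @ [i, h, i] @ ?B, ?A @ [h, i, h] @ ?B) \<in> braid_cong N"
    by (rule braid_cong_contextI[of _ _ _ "?A" "?B"]) (use m in auto)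
  have "(?A @ [h], h # ?A) \<in> braid_cong N"
    by (rule braid_cong_commute) (use assms h m in auto)
  then have 3: "(?A @ [h, i, h] @ ?B, h # ?A @ [i, h] @ ?B) \<in> braid_cong N"
    by (rule braid_cong_contextI[of _ _ _ "[]" "[i, h] @ ?B"]) (use m in auto)
  show ?thesis
    using pres_cong.trans[OF 1 pres_cong.trans[OF 2 3]] by (simp add: split h)
qed

text \<open>One word for each permutation: the run sends \<open>j\<close> to the top point, so it
  picks the coset modulo the permutations fixing that point, and the prefix gives the element of
  that smaller symmetric group.\<close>

fun normal_words :: "nat \<Rightarrow> nat list set" where
  "normal_words 0 = {[]}"
| "normal_words (Suc k) = {u @ desc_run j (Suc k) | u j. u \<in> normal_words k \<and> 1 \<le> j \<and> j \<le> Suc k}"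

lemma normal_words_lists: "u \<in> normal_words k \<Longrightarrow> u \<in> lists {1..<k}"
proof (induction k arbitrary: u)
  case (Suc k)
  then show ?case by fastforce
qed simp

lemma normal_words_SucI:
  "u \<in> normal_words k \<Longrightarrow> 1 \<le> j \<Longrightarrow> j \<le> Suc k \<Longrightarrow> u @ desc_run j (Suc k) \<in> normal_words (Suc k)"
  unfolding normal_words.simps by blast

lemma Nil_in_normal_words: "[] \<in> normal_words k"
proof (induction k)
  case (Suc k)
  then show ?case using normal_words_SucI[of "[]" k "Suc k"] by simp
qed simp

text \<open>A certificate that \<open>w\<close> is not reduced: deleting the square keeps the
  permutation.\<close>

definition has_square :: "nat \<Rightarrow> nat list \<Rightarrow> bool" where
  "has_square N w \<longleftrightarrow> (\<exists>x i y. (w, x @ [i, i] @ y) \<in> braid_cong N)"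

lemma has_square_context:
  assumes "has_square N w" "x \<in> lists {1..<N}" "y \<in> lists {1..<N}"
  shows "has_square N (x @ w @ y)"
proof -
  obtain x' i y' where "(w, x' @ [i, i] @ y') \<in> braid_cong N" using assms(1) has_square_def by blast
  then have "(x @ w @ y, (x @ x') @ [i, i] @ (y' @ y)) \<in> braid_cong N"
    by (rule braid_cong_contextI) (use assms in auto)
  then show ?thesis unfolding has_square_def by blast
qed

lemma has_square_cong:
  "(u, v) \<in> braid_cong N \<Longrightarrow> has_square N v \<Longrightarrow> has_square N u"
  unfolding has_square_def by (blast intro: pres_cong.trans)

text \<open>A letter \<open>i\<close> appended to the run \<open>k, \<dots>, j\<close> either slides through it, as a smaller
  letter, or extends it, or squares its last letter. This replaces the exchange condition in the
  proof of Matsumoto's theorem.\<close>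

lemma normal_form_or_square:
  assumes "k \<le> N" "ws \<in> lists {1..<k}"
  shows "(\<exists>v \<in> normal_words k. (ws, v) \<in> braid_cong N) \<or> has_square N ws"
  using assms
proof (induction k arbitrary: ws)
  case 0
  then show ?case by (simp add: pres_cong.refl)
next
  case (Suc k)
  note outer = Suc.IH
  have N: "k \<le> N" "k < N" using Suc.prems by auto
  show ?case using Suc.prems(2)
  proof (induction ws rule: rev_induct)
    case Nil
    have "[] \<in> normal_words (Suc k)" by (rule Nil_in_normal_words)
    moreover have "([], []) \<in> braid_cong N" by (rule braid_cong_refl) simp
    ultimately show ?case by blast
  next
    case (snoc i ws)
    have i: "i \<in> {1..<Suc k}" and ws: "ws \<in> lists {1..<Suc k}" using snoc.prems by auto
    from snoc.IH[OF ws] show ?case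
    proof
      assume "has_square N ws"
      then have "has_square N ([] @ ws @ [i])"
        by (rule has_square_context) (use i N in auto)
      then show ?thesis by simp
    next
      assume "\<exists>v\<in>normal_words (Suc k). (ws, v) \<in> braid_cong N"
      then obtain u j where u: "u \<in> normal_words k" and j: "1 \<le> j" "j \<le> Suc k"
        and ws': "(ws, u @ desc_run j (Suc k)) \<in> braid_cong N" by auto
      have ul: "u \<in> lists {1..<k}" using u by (rule normal_words_lists)
      then have uN: "u \<in> lists {1..<N}" using N by auto
      have rN: "desc_run j (Suc k) \<in> lists {1..<N}" using j N by auto
      have start: "(ws @ [i], u @ desc_run j (Suc k) @ [i]) \<in> braid_cong N"
        using ws' by (rule braid_cong_contextI[of _ _ _ "[]" "[i]"]) (use i N in auto)
      \<comment> \<open>Covers both cases in which the letter passes through the run and comes out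
        as \<open>h\<close>. The word \<open>u @ [h]\<close> uses only letters below
        \<open>k\<close>, so the outer induction hypothesis applies to it.\<close>
      have move: ?thesis if h: "h \<in> {1..<k}"
        and sl: "(desc_run j (Suc k) @ [i], h # desc_run j (Suc k)) \<in> braid_cong N" for h
      proof -
        have "(u @ desc_run j (Suc k) @ [i], (u @ [h]) @ desc_run j (Suc k)) \<in> braid_cong N"
          using sl by (rule braid_cong_contextI[of _ _ _ u "[]"]) (use uN in auto)
        with start have st: "(ws @ [i], (u @ [h]) @ desc_run j (Suc k)) \<in> braid_cong N"
          by (rule pres_cong.trans)
        have "u @ [h] \<in> lists {1..<k}" using ul h by simp
        from outer[OF N(1) this] show ?thesis
        proof
          assume "has_square N (u @ [h])"
          then have "has_square N ([] @ (u @ [h]) @ desc_run j (Suc k))"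
            by (rule has_square_context) (use rN in auto)
          with st show ?thesis by (auto intro: has_square_cong)
        next
          assume "\<exists>v\<in>normal_words k. (u @ [h], v) \<in> braid_cong N"
          then obtain v where v: "v \<in> normal_words k" "(u @ [h], v) \<in> braid_cong N" by blast
          have "((u @ [h]) @ desc_run j (Suc k), v @ desc_run j (Suc k)) \<in> braid_cong N"
            using v(2) by (rule braid_cong_contextI[of _ _ _ "[]" "desc_run j (Suc k)"]) (use rN in auto)
          with st have "(ws @ [i], v @ desc_run j (Suc k)) \<in> braid_cong N" by (rule pres_cong.trans)
          moreover have "v @ desc_run j (Suc k) \<in> normal_words (Suc k)"
            using v(1) j by (rule normal_words_SucI)
          ultimately show ?thesis by blast
        qed
      qed
      consider "j < i" | "i = j" | "Suc i = j" | "Suc i < j" by linarith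
      then show ?thesis
      proof cases
        case 1
        then show ?thesis
          using desc_run_slide[of j i "Suc k" N] i j N by (intro move[of "i - 1"]) auto
      next
        case 2
        have "desc_run j (Suc k) = desc_run (Suc j) (Suc k) @ [j]"
          using i 2 by (simp add: upt_conv_Cons del: upt_Suc)
        then have "(ws @ [i], (u @ desc_run (Suc j) (Suc k)) @ [i, i] @ []) \<in> braid_cong N"
          using start 2 by simp
        then show ?thesis unfolding has_square_def by blast
      next
        case 3
        have "desc_run i (Suc k) = desc_run j (Suc k) @ [i]"
          using i 3 by (simp add: upt_conv_Cons del: upt_Suc)
        then have "(ws @ [i], u @ desc_run i (Suc k)) \<in> braid_cong N"
          using start by simp
        moreover have "u @ desc_run i (Suc k) \<in> normal_words (Suc k)"
          using u i by (intro normal_words_SucI) auto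
        ultimately show ?thesis by blast
      next
        case 4
        have "(desc_run j (Suc k) @ [i], i # desc_run j (Suc k)) \<in> braid_cong N"
          by (rule braid_cong_commute) (use i j N rN 4 in auto)
        then show ?thesis using i j 4 by (intro move[of i]) auto
      qed
    qed
  qed
qed

lemma perm_of_desc_run: "j \<le> k \<Longrightarrow> perm_of_word (desc_run j k) j = k"
proof (induction k)
  case (Suc k)
  show ?case
  proof (cases "j = Suc k")
    case False
    then show ?thesis using Suc by (simp add: simple_transp_def)
  qed simp
qed simp

text \<open>The last run can be read off the permutation, since its final letter is the preimage of
  the top point. Cancelling the run leaves the prefixes.\<close>

lemma normal_words_inj:
  "u \<in> normal_words k \<Longrightarrow> v \<in> normal_words k \<Longrightarrow> perm_of_word u = perm_of_word v \<Longrightarrow> u = v"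
proof (induction k arbitrary: u v)
  case (Suc k)
  obtain u' i where u: "u = u' @ desc_run i (Suc k)" "u' \<in> normal_words k" "1 \<le> i" "i \<le> Suc k"
    using Suc.prems(1) by auto
  obtain v' j where v: "v = v' @ desc_run j (Suc k)" "v' \<in> normal_words k" "1 \<le> j" "j \<le> Suc k"
    using Suc.prems(2) by auto
  have fix_top: "perm_of_word w (Suc k) = Suc k" if "w \<in> normal_words k" for w
    by (rule permutes_not_in[OF perm_of_word_permutes[OF normal_words_lists[OF that]]]) simp
  have "perm_of_word u i = Suc k" "perm_of_word v j = Suc k"
    using fix_top u v perm_of_desc_run[of i "Suc k"] perm_of_desc_run[of j "Suc k"] by (auto simp del: upt_Suc)
  moreover have "inj (perm_of_word u)"
    using permutes_inj[OF perm_of_word_permutes[OF normal_words_lists[OF Suc.prems(1)]]] .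
  ultimately have ij: "i = j" using Suc.prems(3) by (metis injD)
  have "desc_run j (Suc k) \<in> lists {1..<Suc k}" using v by auto
  then have s: "surj (perm_of_word (desc_run j (Suc k)))"
    using perm_of_word_permutes permutes_surj by blast
  have "perm_of_word u' \<circ> perm_of_word (desc_run j (Suc k)) = perm_of_word v' \<circ> perm_of_word (desc_run j (Suc k))"
    using Suc.prems(3) unfolding u(1) v(1) ij perm_of_word_append .
  then have "perm_of_word u' = perm_of_word v'"
    using s by (metis fun.inj_map_strong surj_fun_eq)
  then show ?case using Suc.IH u v ij by blast
qed simp

text \<open>A reduced word is not equivalent to one with a square: deleting the square would give a
  word for the same permutation with fewer letters than inversions. So both words reach normal
  forms, and these agree because they present the same permutation.\<close>

theorem matsumoto:
  assumes "us \<in> lists {1..<N}" "vs \<in> lists {1..<N}" "perm_of_word us = perm_of_word vs"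
    and "length us = card (inversions (perm_of_word us))"
    and "length vs = card (inversions (perm_of_word vs))"
  shows "(us, vs) \<in> braid_cong N"
proof -
  have nf: "\<exists>v \<in> normal_words N. (ws, v) \<in> braid_cong N"
    if ws: "ws \<in> lists {1..<N}" and len: "length ws = card (inversions (perm_of_word ws))" for ws
  proof (rule ccontr)
    assume "\<not> ?thesis"
    then obtain x i y where c: "(ws, x @ [i, i] @ y) \<in> braid_cong N"
      using normal_form_or_square[OF order_refl ws] has_square_def by blast
    have "simple_transp i \<circ> (simple_transp i \<circ> w) = w" for w by (simp add: o_assoc)
    then have "perm_of_word ws = perm_of_word (x @ y)" "length ws = length (x @ y) + 2"
      using braid_cong_invariants[OF c] by auto
    moreover have "x @ y \<in> lists {1..<N}" using pres_cong_lists[OF c] by auto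
    ultimately show False using card_inversions_le_length[of "x @ y" N] len by simp
  qed
  obtain u v where u: "u \<in> normal_words N" "(us, u) \<in> braid_cong N"
    and v: "v \<in> normal_words N" "(vs, v) \<in> braid_cong N"
    using nf assms by meson
  have "u = v"
    using normal_words_inj[OF u(1) v(1)] braid_cong_invariants[OF u(2)] braid_cong_invariants[OF v(2)] assms(3)
    by simp
  then show ?thesis using u v by (blast intro: pres_cong.trans pres_cong.sym)
qed


section \<open>Multiplying lifted permutations\<close>

text \<open>By Matsumoto's theorem any reduced word may replace the one picked by
  \<open>SOME\<close> in \<open>braid_lift\<close>.\<close>

lemma braid_lift_perm_of_word:
  assumes "ws \<in> lists {1..<N}" "length ws = card (inversions (perm_of_word ws))"
  shows "braid_lift N (perm_of_word ws) = pres_class {1..<N} (braid_rels N) ws"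
proof -
  let ?w = "perm_of_word ws"
  have w: "?w permutes {1..N}" using assms(1) by (rule perm_of_word_permutes)
  define vs where "vs = (SOME vs. vs \<in> reduced_expressions N ?w)"
  have "ws \<in> reduced_expressions N ?w" using assms reduced_expressions_iff[OF w] by blast
  then have "vs \<in> reduced_expressions N ?w" unfolding vs_def by (rule someI)
  then have vs: "vs \<in> lists {1..<N}" "perm_of_word vs = ?w" "length vs = card (inversions ?w)"
    using reduced_expressions_iff[OF w] by auto
  have "braid_lift N ?w = pres_class {1..<N} (braid_rels N) vs"
    using pres_class_eq_word_prod[OF vs(1), of "braid_rels N"]
    unfolding braid_lift_def braid_monoid_def vs_def braid_gen_def by simp
  also have "\<dots> = pres_class {1..<N} (braid_rels N) ws"
    using matsumoto[OF vs(1) assms(1)] vs assms pres_class_eq_iff[OF vs(1) assms(1), of "braid_rels N"] by simp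
  finally show ?thesis .
qed

lemma braid_lift_closed:
  assumes "w permutes {1..N}"
  shows "braid_lift N w \<in> carrier (braid_monoid N)"
proof -
  obtain ws where "ws \<in> lists {1..<N}" "perm_of_word ws = w" "length ws = card (inversions w)"
    using ex_word_length_inversions[OF assms] by blast
  then have "braid_lift N w = pres_class {1..<N} (braid_rels N) ws" "ws \<in> lists {1..<N}"
    using braid_lift_perm_of_word[of ws N] by auto
  then show ?thesis unfolding braid_monoid_def pres_carrier by blast
qed

text \<open>The numbers of inversions add, so reduced words of \<open>u\<close> and \<open>v\<close>
  concatenate to a reduced word of \<open>u \<circ> v\<close>.\<close>

lemma braid_lift_mult:
  assumes u: "u permutes {1..N}" and v: "v permutes {1..N}"
    and sub: "inversions v \<subseteq> inversions (u \<circ> v)"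
  shows "braid_lift N u \<otimes>\<^bsub>braid_monoid N\<^esub> braid_lift N v = braid_lift N (u \<circ> v)"
proof -
  obtain us where us: "us \<in> lists {1..<N}" "perm_of_word us = u" "length us = card (inversions u)"
    using ex_word_length_inversions[OF u] by blast
  obtain vs where vs: "vs \<in> lists {1..<N}" "perm_of_word vs = v" "length vs = card (inversions v)"
    using ex_word_length_inversions[OF v] by blast
  have "braid_lift N u = pres_class {1..<N} (braid_rels N) us"
    "braid_lift N v = pres_class {1..<N} (braid_rels N) vs"
    using braid_lift_perm_of_word[of us N] braid_lift_perm_of_word[of vs N] us vs by simp_all
  moreover have "us @ vs \<in> lists {1..<N}" "perm_of_word (us @ vs) = u \<circ> v" using us vs by simp_all
  moreover have "length (us @ vs) = card (inversions (perm_of_word (us @ vs)))"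
    using card_inversions_comp[OF u v sub] us vs by simp
  ultimately show ?thesis
    using braid_lift_perm_of_word[of "us @ vs" N] pres_mult[OF us(1) vs(1), of "braid_rels N"]
    unfolding braid_monoid_def by simp
qed

lemma involution_apply: "u \<circ> u = id \<Longrightarrow> u (u t) = t"
  by (simp add: fun_eq_iff)

text \<open>The two factorizations \<open>T\<^bsub>y\<^esub> = T\<^bsub>z\<^esub> T\<^bsub>u\<^esub> = T\<^bsub>y \<circ> u \<circ> y\<^esub> T\<^bsub>z\<^esub>\<close> involve the same
  \<open>z = y \<circ> u\<close>.\<close>

lemma braid_lift_conj:
  assumes y: "y permutes {1..N}" "y \<circ> y = id" and u: "u permutes {1..N}" "u \<circ> u = id"
    and sub: "inversions u \<subseteq> inversions y" "inversions (y \<circ> u \<circ> y) \<subseteq> inversions y"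
  shows "braid_lift N y \<otimes>\<^bsub>braid_monoid N\<^esub> braid_lift N u =
    braid_lift N (y \<circ> u \<circ> y) \<otimes>\<^bsub>braid_monoid N\<^esub> braid_lift N y"
proof -
  interpret monoid "braid_monoid N" unfolding braid_monoid_def by (rule monoid_pres_monoid)
  note [simp] = involution_apply[OF y(2)] involution_apply[OF u(2)]
  let ?z = "y \<circ> u" and ?c = "y \<circ> u \<circ> y"
  have z: "?z permutes {1..N}" using u(1) y(1) by (rule permutes_compose)
  have c: "?c permutes {1..N}" using y(1) z by (rule permutes_compose)
  have "?z \<circ> u = y" "?c \<circ> ?z = y" by (simp_all add: fun_eq_iff)
  moreover have "inversions ?z \<subseteq> inversions y"
  proof
    fix p assume "p \<in> inversions ?z"
    then obtain a b where p: "p = (a, b)" "a < b" "y (u b) < y (u a)" by (auto simp: inversions_def)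
    \<comment> \<open>As \<open>?c (y t) = y (u t)\<close>, the pair \<open>(y a, y b)\<close> would
      be an inversion of \<open>?c\<close>, hence of \<open>y\<close>; but \<open>y\<close> sends it
      back to \<open>(a, b)\<close>, with \<open>a < b\<close>.\<close>
    have "\<not> y a < y b"
    proof
      assume "y a < y b"
      then have "(y a, y b) \<in> inversions ?c" using p by (simp add: inversions_def)
      then have "(y a, y b) \<in> inversions y" using sub by blast
      then show False using p by (simp add: inversions_def)
    qed
    moreover have "y a \<noteq> y b" using p by (metis involution_apply[OF y(2)] less_irrefl)
    ultimately show "p \<in> inversions y" using p by (simp add: inversions_def)
  qed
  ultimately have "braid_lift N ?z \<otimes>\<^bsub>braid_monoid N\<^esub> braid_lift N u = braid_lift N y"
    "braid_lift N ?c \<otimes>\<^bsub>braid_monoid N\<^esub> braid_lift N ?z = braid_lift N y"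
    using braid_lift_mult[OF z u(1)] braid_lift_mult[OF c z] sub by simp_all
  then show ?thesis
    using braid_lift_closed[OF z] braid_lift_closed[OF c] braid_lift_closed[OF u(1)] m_assoc by metis
qed

section \<open>Permutations supported on separated intervals\<close>

lemma permutes_interval_apply:
  fixes u :: "nat \<Rightarrow> nat"
  assumes "u permutes {i..j}"
  shows "i \<le> t \<Longrightarrow> t \<le> j \<Longrightarrow> i \<le> u t" "i \<le> t \<Longrightarrow> t \<le> j \<Longrightarrow> u t \<le> j"
    "t < i \<Longrightarrow> u t = t" "j < t \<Longrightarrow> u t = t"
  using permutes_in_image[OF assms, of t] permutes_not_in[OF assms, of t] by auto

lemma inversions_permutes_interval:
  fixes u :: "nat \<Rightarrow> nat"
  assumes "u permutes {i..j}"
  shows "inversions u \<subseteq> {(a, b). i \<le> a \<and> a < b \<and> b \<le> j}"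
proof clarify
  fix a b assume "(a, b) \<in> inversions u"
  then have ab: "a < b" "u b < u a" by (auto simp: inversions_def)
  note p = permutes_interval_apply[OF assms]
  have "i \<le> a" using ab p(1)[of b] p(3)[of a] p(3)[of b] p(4)[of b]
    by (metis le_less_trans less_imp_le not_le)
  moreover have "b \<le> j" using ab p(2)[of a] p(3)[of a] p(4)[of a] p(4)[of b]
    by (metis le_less_trans less_imp_le not_le)
  ultimately show "i \<le> a \<and> a < b \<and> b \<le> j" using ab by simp
qed

lemma comp_commute_separated:
  fixes u v :: "nat \<Rightarrow> nat"
  assumes "u permutes {i..c}" "v permutes {d..j}" "c < d"
  shows "u \<circ> v = v \<circ> u"
proof
  fix t
  show "(u \<circ> v) t = (v \<circ> u) t"
    using permutes_interval_apply[OF assms(1), of t] permutes_interval_apply[OF assms(1), of "v t"]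
      permutes_interval_apply[OF assms(2), of t] permutes_interval_apply[OF assms(2), of "u t"] assms(3)
    by (cases "t \<le> c"; cases "i \<le> t"; cases "d \<le> t"; cases "t \<le> j"; simp)
qed

lemma inversions_comp_separated:
  fixes u v :: "nat \<Rightarrow> nat"
  assumes u: "u permutes {i..c}" and v: "v permutes {d..j}" and "c < d"
  shows "inversions (u \<circ> v) = inversions u \<union> inversions v"
proof (intro subset_antisym subsetI)
  note p = permutes_interval_apply[OF u] permutes_interval_apply[OF v]
  fix x assume "x \<in> inversions (u \<circ> v)"
  then obtain a b where x: "x = (a, b)" "a < b" "u (v b) < u (v a)" by (auto simp: inversions_def)
  show "x \<in> inversions u \<union> inversions v"
  proof (cases "b < d")
    case True
    then have "v a = a" "v b = b" using p(7) x by auto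
    then show ?thesis using x by (simp add: inversions_def)
  next
    case False
    \<comment> \<open>The positions below \<open>d\<close> and those from \<open>d\<close> on are
      each preserved, so no pair straddling the cut is inverted.\<close>
    have top: "d \<le> v t \<and> u (v t) = v t" if "d \<le> t" for t
      using that p(4)[of "v t"] p(5)[of t] p(8)[of t] \<open>c < d\<close> by (cases "t \<le> j") auto
    have bot: "u (v t) < d" if "t < d" for t
      using that p(7)[of t] p(2)[of t] p(3)[of t] p(4)[of t] \<open>c < d\<close> by (cases "i \<le> t"; cases "t \<le> c") auto
    have "d \<le> a" using x top[of b] bot[of a] False by (metis leI le_less_trans not_less order_less_trans)
    then show ?thesis using x top[of a] top[of b] by (simp add: inversions_def)
  qed
next
  note p = permutes_interval_apply[OF u] permutes_interval_apply[OF v]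
  fix x assume "x \<in> inversions u \<union> inversions v"
  then show "x \<in> inversions (u \<circ> v)"
  proof
    assume x: "x \<in> inversions u"
    then obtain a b where "x = (a, b)" "i \<le> a" "a < b" "b \<le> c"
      using inversions_permutes_interval[OF u] by blast
    then show ?thesis using x p(7)[of a] p(7)[of b] \<open>c < d\<close> by (simp add: inversions_def)
  next
    assume x: "x \<in> inversions v"
    then obtain a b where ab: "x = (a, b)" "d \<le> a" "a < b" "b \<le> j"
      using inversions_permutes_interval[OF v] by blast
    then have "u (v a) = v a" "u (v b) = v b"
      using p(4)[of "v a"] p(4)[of "v b"] p(5)[of a] p(5)[of b] \<open>c < d\<close> by auto
    then show ?thesis using x ab by (simp add: inversions_def)
  qed
qed

lemma permutes_interval_mono:
  fixes u :: "nat \<Rightarrow> nat"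
  shows "u permutes {i..j} \<Longrightarrow> i' \<le> i \<Longrightarrow> j \<le> j' \<Longrightarrow> u permutes {i'..j'}"
  by (rule permutes_subset) auto

lemma braid_lift_separated:
  fixes u v :: "nat \<Rightarrow> nat"
  assumes u: "u permutes {i..c}" and v: "v permutes {d..j}"
    and "c < d" "1 \<le> i" "c \<le> N" "1 \<le> d" "j \<le> N"
  shows "braid_lift N u \<otimes>\<^bsub>braid_monoid N\<^esub> braid_lift N v = braid_lift N (u \<circ> v)"
    and "braid_lift N v \<otimes>\<^bsub>braid_monoid N\<^esub> braid_lift N u = braid_lift N (u \<circ> v)"
proof -
  have N: "u permutes {1..N}" "v permutes {1..N}"
    using u v assms(3-) by (auto elim!: permutes_interval_mono)
  show "braid_lift N u \<otimes>\<^bsub>braid_monoid N\<^esub> braid_lift N v = braid_lift N (u \<circ> v)"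
    by (rule braid_lift_mult) (use N inversions_comp_separated[OF u v \<open>c < d\<close>] in auto)
  have "braid_lift N v \<otimes>\<^bsub>braid_monoid N\<^esub> braid_lift N u = braid_lift N (v \<circ> u)"
    by (rule braid_lift_mult)
      (use N inversions_comp_separated[OF u v \<open>c < d\<close>] comp_commute_separated[OF u v \<open>c < d\<close>] in auto)
  then show "braid_lift N v \<otimes>\<^bsub>braid_monoid N\<^esub> braid_lift N u = braid_lift N (u \<circ> v)"
    by (simp only: comp_commute_separated[OF u v \<open>c < d\<close>])
qed


section \<open>Longest elements of parabolic subgroups\<close>

text \<open>The pairs of positions that lie in one orbit of the parabolic subgroup; in root
  language, its positive roots.\<close>

definition parabolic_pairs :: "nat set \<Rightarrow> (nat \<times> nat) set" where
  "parabolic_pairs L = {(a, b). a < b \<and> {a..<b} \<subseteq> L}"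

lemma parabolic_permutes:
  assumes "L \<subseteq> {1..<N}" "w \<in> parabolic N L" shows "w permutes {1..N}"
proof -
  interpret group "sym_group N" by (rule sym_group_is_group)
  have "simple_transp ` L \<subseteq> carrier (sym_group N)"
    using assms(1) simple_transp_permutes[of _ N] unfolding sym_group_def by auto
  from generate_in_carrier[OF this] assms(2) show ?thesis
    unfolding parabolic_def sym_group_carrier by blast
qed

lemma parabolic_compI: "u \<in> parabolic N L \<Longrightarrow> v \<in> parabolic N L \<Longrightarrow> u \<circ> v \<in> parabolic N L"
  using generate.eng[of u "sym_group N" _ v] unfolding parabolic_def sym_group_mult by blast

text \<open>For \<open>i \<notin> L\<close> every element of the subgroup preserves \<open>{..i}\<close>.\<close>

lemma inversions_parabolic:
  assumes L: "L \<subseteq> {1..<N}" and "w \<in> parabolic N L"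
  shows "inversions w \<subseteq> parabolic_pairs L"
proof -
  have inv_st: "inv\<^bsub>sym_group N\<^esub> (simple_transp i) = simple_transp i" if "i \<in> L" for i
  proof -
    have "simple_transp i \<in> carrier (sym_group N)"
      using that L simple_transp_permutes[of i N] by (auto simp: sym_group_def)
    then show ?thesis
      using inv_unique_comp[of "simple_transp i" "simple_transp i"] by simp
  qed
  have st: "simple_transp l t \<le> i \<longleftrightarrow> t \<le> i" if "l \<in> L" "i \<notin> L" for l i t
  proof -
    have "l \<noteq> i" using that by blast
    then show ?thesis by (auto simp: simple_transp_def transpose_def)
  qed
  have pres: "w t \<le> i \<longleftrightarrow> t \<le> i" if "i \<notin> L" for i t
    using assms(2) unfolding parabolic_def
  proof (induction arbitrary: t rule: generate.induct)
    case one then show ?case by (simp add: sym_group_one)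
  next
    case (incl h) then show ?case using st that by blast
  next
    case (inv h) then show ?case using st that inv_st by auto
  next
    case (eng u v) then show ?case by (simp add: sym_group_mult)
  qed
  show ?thesis
  proof
    fix x assume "x \<in> inversions w"
    then obtain a b where x: "x = (a, b)" "a < b" "w b < w a" by (auto simp: inversions_def)
    have "i \<in> L" if "a \<le> i" "i < b" for i
    proof (rule ccontr)
      assume "i \<notin> L"
      with that have "w a \<le> i" "\<not> w b \<le> i" using pres by auto
      with x show False by simp
    qed
    with x show "x \<in> parabolic_pairs L" by (auto simp: parabolic_pairs_def)
  qed
qed

lemma longest_elt_in_parabolic:
  assumes L: "L \<subseteq> {1..<N}"
  shows "longest_elt N L \<in> parabolic N L"
    and "w \<in> parabolic N L \<Longrightarrow> card (inversions w) \<le> card (inversions (longest_elt N L))"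
proof -
  let ?P = "\<lambda>w. w \<in> parabolic N L"
  have id: "?P id" using generate.one[of "sym_group N"] unfolding parabolic_def sym_group_one by blast
  \<comment> \<open>\<open>ARG_MAX\<close> yields a maximum only for a bounded function, and the
    number of all pairs of positions is a bound.\<close>
  have bd: "\<forall>w. ?P w \<longrightarrow> perm_length N w < Suc (card ({1..N} \<times> {1..N}))"
  proof (intro allI impI)
    fix w assume "?P w"
    then have w: "w permutes {1..N}" using parabolic_permutes[OF L] by blast
    have "inversions w \<subseteq> {1..N} \<times> {1..N}" using inversions_subset[OF w] by auto
    from card_mono[OF _ this] show "perm_length N w < Suc (card ({1..N} \<times> {1..N}))"
      by (simp add: perm_length_eq[OF w] less_Suc_eq_le)
  qed
  show 1: "longest_elt N L \<in> parabolic N L"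
    unfolding longest_elt_def using arg_max_natI[of ?P, OF id bd] .
  assume w: "w \<in> parabolic N L"
  have "perm_length N w \<le> perm_length N (longest_elt N L)"
    unfolding longest_elt_def using arg_max_nat_le[of ?P, OF w bd] .
  then show "card (inversions w) \<le> card (inversions (longest_elt N L))"
    using perm_length_eq parabolic_permutes[OF L] 1 w by metis
qed

lemma longest_elt_permutes: "L \<subseteq> {1..<N} \<Longrightarrow> longest_elt N L permutes {1..N}"
  using longest_elt_in_parabolic(1) parabolic_permutes by blast

text \<open>Each \<open>i \<in> L\<close> is a descent, since otherwise multiplying by
  \<open>simple_transp i\<close> would give a longer element of the subgroup. A chain of descents
  from \<open>a\<close> to \<open>b\<close> makes \<open>(a, b)\<close> an inversion.\<close>

lemma inversions_longest_elt:
  assumes L: "L \<subseteq> {1..<N}"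
  shows "inversions (longest_elt N L) = parabolic_pairs L"
proof
  let ?w = "longest_elt N L"
  note w = longest_elt_permutes[OF L]
  show "inversions ?w \<subseteq> parabolic_pairs L"
    using inversions_parabolic[OF L longest_elt_in_parabolic(1)[OF L]] .
  have desc: "?w (Suc i) < ?w i" if i: "i \<in> L" for i
  proof -
    have "simple_transp i \<in> parabolic N L"
      unfolding parabolic_def using i by (blast intro: generate.incl)
    then have "card (inversions (?w \<circ> simple_transp i)) \<le> card (inversions ?w)"
      by (intro longest_elt_in_parabolic[OF L] parabolic_compI)
    moreover have "i \<in> {1..<N}" using i L by blast
    ultimately have "\<not> ?w i < ?w (i + 1)" using card_inversions_ascent[OF w] by force
    moreover have "?w i \<noteq> ?w (i + 1)" using inj_eq[OF permutes_inj[OF w]] by simp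
    ultimately show ?thesis by simp
  qed
  have "?w b < ?w a" if "a < b" "{a..<b} \<subseteq> L" for a b
    using that
  proof (induction b)
    case (Suc b)
    have "b \<in> L" using Suc.prems by auto
    then have "?w (Suc b) < ?w b" by (rule desc)
    moreover have "a = b \<or> ?w b < ?w a" using Suc by (cases "a = b") (auto simp: subset_iff)
    ultimately show ?case by (metis less_trans)
  qed simp
  then show "parabolic_pairs L \<subseteq> inversions ?w"
    by (auto simp: parabolic_pairs_def inversions_def)
qed

lemma longest_elt_eqI:
  assumes "L \<subseteq> {1..<N}" "w permutes {1..N}" "inversions w = parabolic_pairs L"
  shows "longest_elt N L = w"
  using inversions_inj[OF longest_elt_permutes] inversions_longest_elt assms by blast

text \<open>The inverse lies in the same subgroup and has equally many inversions, so it too inverts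
  every admissible pair; the inversions determine the element.\<close>

lemma longest_elt_involution:
  assumes L: "L \<subseteq> {1..<N}"
  shows "longest_elt N L \<circ> longest_elt N L = id"
proof -
  let ?w = "longest_elt N L"
  note w = longest_elt_permutes[OF L]
  interpret group "sym_group N" by (rule sym_group_is_group)
  have sub: "simple_transp ` L \<subseteq> carrier (sym_group N)"
    using L simple_transp_permutes[of _ N] unfolding sym_group_def by auto
  have "?w \<in> carrier (sym_group N)" using w by (simp add: sym_group_carrier)
  then have "inv' ?w \<in> parabolic N L"
    using generate_m_inv_closed[OF sub] longest_elt_in_parabolic(1)[OF L] unfolding parabolic_def by force
  then have "inversions (inv' ?w) \<subseteq> parabolic_pairs L" by (rule inversions_parabolic[OF L])
  moreover have "card (inversions (inv' ?w)) = card (inversions ?w)"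
  proof (rule bij_betw_same_card)
    have iv: "inv' ?w (?w t) = t" "?w (inv' ?w t) = t" for t using permutes_inverses[OF w] by auto
    show "bij_betw (\<lambda>(a, b). (inv' ?w b, inv' ?w a)) (inversions (inv' ?w)) (inversions ?w)"
      by (rule bij_betwI[where g = "\<lambda>(a, b). (?w b, ?w a)"]) (auto simp: inversions_def iv)
  qed
  moreover have "finite (inversions ?w)" using finite_inversions[OF w] .
  ultimately have "inversions (inv' ?w) = parabolic_pairs L"
    using inversions_longest_elt[OF L] by (metis card_subset_eq)
  then have "?w = inv' ?w" using longest_elt_eqI[OF L permutes_inv[OF w]] by blast
  then show ?thesis using permutes_inv_o(1)[OF w] by simp
qed

text \<open>A point outside the interval belongs to no inversion, so its image has as many points
  below it as the point itself.\<close>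

lemma permutes_interval_of_inversions:
  fixes w :: "nat \<Rightarrow> nat"
  assumes w: "w permutes {1..N}" and inv: "inversions w \<subseteq> {(a, b). i \<le> a \<and> a < b \<and> b \<le> j}"
  shows "w permutes {i..j}"
proof (rule permutes_superset[OF w])
  fix t assume t: "t \<in> {1..N} - {i..j}"
  have lt: "s < t \<longleftrightarrow> w s < w t" for s
  proof -
    have "(s, t) \<notin> inversions w" "(t, s) \<notin> inversions w" using inv t by auto
    then have "s < t \<Longrightarrow> \<not> w t < w s" "t < s \<Longrightarrow> \<not> w s < w t" by (auto simp: inversions_def)
    moreover have "w s = w t \<longleftrightarrow> s = t" using inj_eq[OF permutes_inj[OF w]] .
    ultimately show ?thesis by (metis linorder_neqE_nat less_irrefl)
  qed
  have "w ` {..<t} = {..<w t}"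
  proof
    show "{..<w t} \<subseteq> w ` {..<t}"
    proof
      fix x assume x: "x \<in> {..<w t}"
      obtain s where "x = w s" using permutes_surj[OF w] by (metis surjD)
      with x lt show "x \<in> w ` {..<t}" by auto
    qed
  qed (use lt in auto)
  moreover have "card (w ` {..<t}) = card {..<t}"
    by (rule card_image) (rule inj_on_subset[OF permutes_inj[OF w]], simp)
  ultimately show "w t = t" by simp
qed

lemma permutes_longest_elt_interval:
  assumes "L \<subseteq> {i..<j}" "1 \<le> i" "j \<le> N"
  shows "longest_elt N L permutes {i..j}"
proof (rule permutes_interval_of_inversions)
  have L: "L \<subseteq> {1..<N}" using assms by auto
  show "longest_elt N L permutes {1..N}" using L by (rule longest_elt_permutes)
  show "inversions (longest_elt N L) \<subseteq> {(a, b). i \<le> a \<and> a < b \<and> b \<le> j}"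
    unfolding inversions_longest_elt[OF L]
  proof clarify
    fix a b assume "(a, b) \<in> parabolic_pairs L"
    then have ab: "a < b" "{a..<b} \<subseteq> L" by (auto simp: parabolic_pairs_def)
    then have "a \<in> L" "b - 1 \<in> L" by auto
    then have "a \<in> {i..<j}" "b - 1 \<in> {i..<j}" using assms(1) by blast+
    then show "i \<le> a \<and> a < b \<and> b \<le> j" using ab by auto
  qed
qed

lemma parabolic_pairs_Un:
  assumes "L1 \<subseteq> {..<c}" "L2 \<subseteq> {c<..}"
  shows "parabolic_pairs (L1 \<union> L2) = parabolic_pairs L1 \<union> parabolic_pairs L2"
proof (intro subset_antisym subsetI)
  fix x assume "x \<in> parabolic_pairs (L1 \<union> L2)"
  then obtain a b where x: "x = (a, b)" "a < b" "{a..<b} \<subseteq> L1 \<union> L2"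
    by (auto simp: parabolic_pairs_def)
  \<comment> \<open>The index \<open>c\<close> is missing from both sets, so an interval of indices
    contained in the union cannot pass it.\<close>
  have "c \<notin> {a..<b}" using x assms by blast
  then have "b \<le> c \<or> c < a" by auto
  then have "{a..<b} \<subseteq> L1 \<or> {a..<b} \<subseteq> L2"
  proof
    assume "b \<le> c"
    then have "{a..<b} \<inter> L2 = {}" using assms(2) by force
    then show ?thesis using x(3) by blast
  next
    assume "c < a"
    then have "{a..<b} \<inter> L1 = {}" using assms(1) by force
    then show ?thesis using x(3) by blast
  qed
  then show "x \<in> parabolic_pairs L1 \<union> parabolic_pairs L2"
    using x by (auto simp: parabolic_pairs_def)
qed (unfold parabolic_pairs_def, blast)

text \<open>Detaches \<open>K\<close> and \<open>J\<close> from the long intervals they are joined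
  to. Indices in \<open>{i..<c}\<close> move positions up to and including \<open>c\<close>, hence
  the strict inequality \<open>c < d\<close>.\<close>

lemma longest_elt_Un:
  assumes "L1 \<subseteq> {i..<c}" "L2 \<subseteq> {d..<j}" "c < d" "1 \<le> i" "c \<le> N" "1 \<le> d" "j \<le> N"
  shows "longest_elt N (L1 \<union> L2) = longest_elt N L1 \<circ> longest_elt N L2"
proof (rule longest_elt_eqI)
  have L: "L1 \<subseteq> {1..<N}" "L2 \<subseteq> {1..<N}" using assms by auto
  then show "L1 \<union> L2 \<subseteq> {1..<N}" by blast
  show "longest_elt N L1 \<circ> longest_elt N L2 permutes {1..N}"
    using L by (intro permutes_compose longest_elt_permutes)
  have p: "longest_elt N L1 permutes {i..c}" "longest_elt N L2 permutes {d..j}"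
    using assms by (auto intro: permutes_longest_elt_interval)
  show "inversions (longest_elt N L1 \<circ> longest_elt N L2) = parabolic_pairs (L1 \<union> L2)"
    using inversions_comp_separated[OF p \<open>c < d\<close>] inversions_longest_elt L
      parabolic_pairs_Un[of L1 c L2] assms by force
qed


section \<open>Reversals and block swaps\<close>

text \<open>Its lift is the half twist of the strands from \<open>i\<close> to
  \<open>j\<close>.\<close>

definition reversal :: "nat \<Rightarrow> nat \<Rightarrow> nat \<Rightarrow> nat" where
  "reversal i j t = (if i \<le> t \<and> t \<le> j then i + j - t else t)"

text \<open>\<open>block_swap c a b\<close> moves the block of length \<open>a\<close> that follows position \<open>c\<close> past the
  next block, of length \<open>b\<close>.\<close>

definition block_swap :: "nat \<Rightarrow> nat \<Rightarrow> nat \<Rightarrow> nat \<Rightarrow> nat" where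
  "block_swap c a b t =
    (if c < t \<and> t \<le> c + a then t + b else if c + a < t \<and> t \<le> c + a + b then t - a else t)"

lemma reversal_reversal [simp]: "reversal i j (reversal i j t) = t"
  by (auto simp: reversal_def)

lemma reversal_involution: "reversal i j \<circ> reversal i j = id"
  by (simp add: fun_eq_iff)

lemma reversal_permutes: "reversal i j permutes {i..j}"
proof (rule bij_imp_permutes)
  show "bij_betw (reversal i j) {i..j} {i..j}"
    by (rule bij_betwI[where g = "reversal i j"]) (auto simp: reversal_def)
qed (auto simp: reversal_def)

lemma block_swap_inverse [simp]: "block_swap c b a (block_swap c a b t) = t"
  by (auto simp: block_swap_def)

lemma block_swap_permutes: "block_swap c a b permutes {c + 1..c + a + b}"
proof (rule bij_imp_permutes)
  show "bij_betw (block_swap c a b) {c + 1..c + a + b} {c + 1..c + a + b}"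
    by (rule bij_betwI[where g = "block_swap c b a"])
      (simp_all, (auto simp: block_swap_def))
qed (auto simp: block_swap_def)

lemma inversions_reversal: "inversions (reversal i j) = {(a, b). i \<le> a \<and> a < b \<and> b \<le> j}"
  by (auto simp: inversions_def reversal_def split: if_splits)

lemma inversions_block_swap:
  "inversions (block_swap c a b) = {(s, t). c < s \<and> s \<le> c + a \<and> c + a < t \<and> t \<le> c + a + b}"
proof -
  have "block_swap c a b t < block_swap c a b s \<longleftrightarrow> c < s \<and> s \<le> c + a \<and> c + a < t \<and> t \<le> c + a + b"
    if "s < t" for s t
    using that
    by (cases "s \<le> c"; cases "s \<le> c + a"; cases "t \<le> c"; cases "t \<le> c + a"; cases "t \<le> c + a + b";
        cases "s \<le> c + a + b"; simp add: block_swap_def; linarith?)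
  then show ?thesis unfolding inversions_def by auto
qed

lemma longest_elt_interval:
  assumes "1 \<le> i" "j \<le> N"
  shows "longest_elt N {i..<j} = reversal i j"
proof (rule longest_elt_eqI)
  show "reversal i j permutes {1..N}"
    using permutes_interval_mono[OF reversal_permutes] assms .
  have "{a..<b} \<subseteq> {i..<j} \<longleftrightarrow> i \<le> a \<and> b \<le> j" if "a < b" for a b
    using that by auto
  then show "inversions (reversal i j) = parabolic_pairs {i..<j}"
    unfolding inversions_reversal parabolic_pairs_def by blast
qed (use assms in auto)

text \<open>Conjugation by the reversal takes the transposition with index \<open>t\<close> to the
  one with index \<open>i + j - 1 - t\<close>, so it maps the parabolic subgroup of \<open>L\<close>
  to itself. The proof compares inversion sets.\<close>

lemma reversal_longest_elt:
  assumes L: "L \<subseteq> {i..<j}" and flip: "L = (\<lambda>t. i + j - 1 - t) ` L" and "1 \<le> i" "j \<le> N"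
  shows "reversal i j \<circ> longest_elt N L \<circ> reversal i j = longest_elt N L"
proof (rule longest_elt_eqI[symmetric])
  let ?w = "longest_elt N L" and ?r = "reversal i j"
  show L': "L \<subseteq> {1..<N}" using assms by auto
  have w: "?w permutes {i..j}" using assms by (intro permutes_longest_elt_interval)
  have p: "?r \<circ> ?w \<circ> ?r permutes {i..j}"
    by (intro permutes_compose reversal_permutes w)
  then show "?r \<circ> ?w \<circ> ?r permutes {1..N}" using assms(3,4) by (rule permutes_interval_mono)
  have in_flip: "t \<in> L \<longleftrightarrow> i + j - 1 - t \<in> L" if "t \<in> {i..<j}" for t
  proof
    show "t \<in> L \<Longrightarrow> i + j - 1 - t \<in> L" using flip by blast
    assume "i + j - 1 - t \<in> L"
    then have "i + j - 1 - (i + j - 1 - t) \<in> L" using flip by blast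
    moreover have "i + j - 1 - (i + j - 1 - t) = t" using that by auto
    ultimately show "t \<in> L" by simp
  qed
  have "(a, b) \<in> inversions (?r \<circ> ?w \<circ> ?r) \<longleftrightarrow> (a, b) \<in> parabolic_pairs L"
    if ab: "i \<le> a" "a < b" "b \<le> j" for a b
  proof -
    have ra: "?r a = i + j - a" "?r b = i + j - b" using ab by (auto simp: reversal_def)
    have "i \<le> ?w t \<and> ?w t \<le> j" if "i \<le> t" "t \<le> j" for t
      using permutes_interval_apply[OF w] that by blast
    then have "?r (?w (?r t)) = i + j - ?w (?r t)" "i \<le> ?w (?r t)" "?w (?r t) \<le> j" if "i \<le> t" "t \<le> j" for t
      using permutes_interval_apply[OF reversal_permutes[of i j]] that by (auto simp: reversal_def)
    note conj = this
    have "i \<le> ?w (?r a)" "?w (?r a) \<le> j" "i \<le> ?w (?r b)" "?w (?r b) \<le> j"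
      "?r (?w (?r a)) = i + j - ?w (?r a)" "?r (?w (?r b)) = i + j - ?w (?r b)"
      using ab by (auto intro!: conj)
    then have "(a, b) \<in> inversions (?r \<circ> ?w \<circ> ?r) \<longleftrightarrow> ?w (?r a) < ?w (?r b)"
      using ab(2) unfolding inversions_def by simp linarith
    also have "\<dots> \<longleftrightarrow> (?r b, ?r a) \<in> inversions ?w" using ab ra by (auto simp: inversions_def)
    also have "\<dots> \<longleftrightarrow> {i + j - b..<i + j - a} \<subseteq> L"
      using ab ra unfolding inversions_longest_elt[OF L'] by (auto simp: parabolic_pairs_def)
    \<comment> \<open>Positions are reflected by \<open>i + j - t\<close>, but the index
      \<open>t\<close> stands for the gap between \<open>t\<close> and \<open>t + 1\<close>, so
      indices are reflected by \<open>i + j - 1 - t\<close>.\<close>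
    also have "{i + j - b..<i + j - a} = (\<lambda>t. i + j - 1 - t) ` {a..<b}"
    proof
      show "{i + j - b..<i + j - a} \<subseteq> (\<lambda>t. i + j - 1 - t) ` {a..<b}"
      proof
        fix t assume "t \<in> {i + j - b..<i + j - a}"
        then show "t \<in> (\<lambda>t. i + j - 1 - t) ` {a..<b}"
          using ab by (intro image_eqI[of _ _ "i + j - 1 - t"]) auto
      qed
    qed (use ab in auto)
    also have "\<dots> \<subseteq> L \<longleftrightarrow> {a..<b} \<subseteq> L"
      using in_flip ab by (auto simp: image_subset_iff subset_iff)
    also have "\<dots> \<longleftrightarrow> (a, b) \<in> parabolic_pairs L" using ab by (simp add: parabolic_pairs_def)
    finally show ?thesis .
  qed
  moreover have "inversions (?r \<circ> ?w \<circ> ?r) \<subseteq> {(a, b). i \<le> a \<and> a < b \<and> b \<le> j}"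
    using inversions_permutes_interval[OF p] .
  moreover have "parabolic_pairs L \<subseteq> {(a, b). i \<le> a \<and> a < b \<and> b \<le> j}"
    using inversions_permutes_interval[OF w] unfolding inversions_longest_elt[OF L'] .
  ultimately show "inversions (?r \<circ> ?w \<circ> ?r) = parabolic_pairs L" by blast
qed

text \<open>Swap two adjacent cables, then reverse each in its new place, where the one of
  \<open>b\<close> strands comes first. Every pair inverted by the swap is still inverted at the
  end.\<close>

lemma braid_lift_reversal_left:
  assumes "c + a + b \<le> N"
  shows "braid_lift N (reversal (c + 1) (c + a + b)) =
    braid_lift N (reversal (c + 1) (c + b)) \<otimes>\<^bsub>braid_monoid N\<^esub>
    braid_lift N (reversal (c + b + 1) (c + a + b)) \<otimes>\<^bsub>braid_monoid N\<^esub>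
    braid_lift N (block_swap c a b)"
proof -
  let ?r = "reversal (c + 1) (c + b)" and ?s = "reversal (c + b + 1) (c + a + b)"
  have eq: "?r \<circ> ?s \<circ> block_swap c a b = reversal (c + 1) (c + a + b)"
  proof
    fix t
    consider "t \<le> c" | "c < t" "t \<le> c + a" | "c + a < t" "t \<le> c + a + b" | "c + a + b < t" by linarith
    then show "(?r \<circ> ?s \<circ> block_swap c a b) t = reversal (c + 1) (c + a + b) t"
      by cases (auto simp: reversal_def block_swap_def)
  qed
  have p: "?r \<circ> ?s permutes {1..N}" "block_swap c a b permutes {1..N}"
    using assms
    by (intro permutes_compose permutes_interval_mono[OF reversal_permutes]
        permutes_interval_mono[OF block_swap_permutes]; simp)+
  have "braid_lift N ?r \<otimes>\<^bsub>braid_monoid N\<^esub> braid_lift N ?s = braid_lift N (?r \<circ> ?s)"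
    using assms by (intro braid_lift_separated[OF reversal_permutes reversal_permutes]) auto
  moreover have "braid_lift N (?r \<circ> ?s) \<otimes>\<^bsub>braid_monoid N\<^esub> braid_lift N (block_swap c a b)
      = braid_lift N (?r \<circ> ?s \<circ> block_swap c a b)"
    by (rule braid_lift_mult[OF p]) (auto simp only: eq inversions_reversal inversions_block_swap)
  ultimately show ?thesis by (simp only: eq)
qed

text \<open>The same half twist with each cable reversed in its old place, before the swap.\<close>

lemma braid_lift_reversal_right:
  assumes "c + a + b \<le> N"
  shows "braid_lift N (reversal (c + 1) (c + a + b)) =
    braid_lift N (block_swap c a b) \<otimes>\<^bsub>braid_monoid N\<^esub>
    (braid_lift N (reversal (c + 1) (c + a)) \<otimes>\<^bsub>braid_monoid N\<^esub>
     braid_lift N (reversal (c + a + 1) (c + a + b)))"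
proof -
  let ?r = "reversal (c + 1) (c + a)" and ?s = "reversal (c + a + 1) (c + a + b)"
  have eq: "block_swap c a b \<circ> (?r \<circ> ?s) = reversal (c + 1) (c + a + b)"
  proof
    fix t
    consider "t \<le> c" | "c < t" "t \<le> c + a" | "c + a < t" "t \<le> c + a + b" | "c + a + b < t" by linarith
    then show "(block_swap c a b \<circ> (?r \<circ> ?s)) t = reversal (c + 1) (c + a + b) t"
      by cases (auto simp: reversal_def block_swap_def)
  qed
  have p: "?r \<circ> ?s permutes {1..N}" "block_swap c a b permutes {1..N}"
    using assms
    by (intro permutes_compose permutes_interval_mono[OF reversal_permutes]
        permutes_interval_mono[OF block_swap_permutes]; simp)+
  have "braid_lift N ?r \<otimes>\<^bsub>braid_monoid N\<^esub> braid_lift N ?s = braid_lift N (?r \<circ> ?s)"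
    using assms by (intro braid_lift_separated[OF reversal_permutes reversal_permutes]) auto
  moreover have sep: "inversions (?r \<circ> ?s) = inversions ?r \<union> inversions ?s"
    by (rule inversions_comp_separated[OF reversal_permutes reversal_permutes]) simp
  have "inversions (?r \<circ> ?s) \<subseteq> inversions (block_swap c a b \<circ> (?r \<circ> ?s))"
    unfolding eq sep unfolding inversions_reversal by auto
  then have "braid_lift N (block_swap c a b) \<otimes>\<^bsub>braid_monoid N\<^esub> braid_lift N (?r \<circ> ?s)
      = braid_lift N (block_swap c a b \<circ> (?r \<circ> ?s))"
    by (rule braid_lift_mult[OF p(2,1)])
  ultimately show ?thesis by (simp only: eq)
qed

text \<open>The right factor acts first: the rear part of \<open>q\<close> strands crosses the
  \<open>b\<close> strands, and then the front part of \<open>p\<close> strands follows.\<close>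

lemma braid_lift_block_swap_left:
  assumes "c + p + q + b \<le> N"
  shows "braid_lift N (block_swap c p b) \<otimes>\<^bsub>braid_monoid N\<^esub> braid_lift N (block_swap (c + p) q b)
    = braid_lift N (block_swap c (p + q) b)"
proof -
  have eq: "block_swap c p b \<circ> block_swap (c + p) q b = block_swap c (p + q) b"
    by (auto simp: fun_eq_iff block_swap_def)
  have "block_swap c p b permutes {1..N}" "block_swap (c + p) q b permutes {1..N}"
    using assms by (auto intro!: permutes_interval_mono[OF block_swap_permutes])
  then show ?thesis
    unfolding eq[symmetric] by (rule braid_lift_mult) (auto simp only: eq inversions_block_swap)
qed

lemma braid_lift_block_swap_right:
  assumes "c + a + p + q \<le> N"
  shows "braid_lift N (block_swap (c + p) a q) \<otimes>\<^bsub>braid_monoid N\<^esub> braid_lift N (block_swap c a p)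
    = braid_lift N (block_swap c a (p + q))"
proof -
  have eq: "block_swap (c + p) a q \<circ> block_swap c a p = block_swap c a (p + q)"
    by (auto simp: fun_eq_iff block_swap_def)
  have "block_swap (c + p) a q permutes {1..N}" "block_swap c a p permutes {1..N}"
    using assms by (auto intro!: permutes_interval_mono[OF block_swap_permutes])
  then show ?thesis
    unfolding eq[symmetric] by (rule braid_lift_mult) (auto simp only: eq inversions_block_swap)
qed

section \<open>Exchange of the two halves\<close>

lemma half_swap_apply:
  "t \<in> {1..n} \<Longrightarrow> block_swap 0 n n t = t + n"
  "t \<in> {n + 1..2 * n} \<Longrightarrow> block_swap 0 n n t = t - n"
  by (auto simp: block_swap_def)

lemma half_swap_conj_permutes:
  assumes u: "u permutes {i..j}"
  shows "1 \<le> i \<Longrightarrow> j \<le> n \<Longrightarrow> block_swap 0 n n \<circ> u \<circ> block_swap 0 n n permutes {n + i..n + j}"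
    and "n + 1 \<le> i \<Longrightarrow> j \<le> 2 * n \<Longrightarrow> block_swap 0 n n \<circ> u \<circ> block_swap 0 n n permutes {i - n..j - n}"
proof -
  let ?x = "block_swap 0 n n"
  note p = permutes_interval_apply[OF u]
  have bij: "bij_betw (?x \<circ> u \<circ> ?x) (?x ` {i..j}) (?x ` {i..j})"
  proof -
    have "inj ?x" by (rule inj_on_inverseI[of _ ?x]) simp
    then have x: "bij_betw ?x A (?x ` A)" for A
      by (meson bij_betw_imageI inj_on_subset subset_UNIV)
    have "?x ` ?x ` {i..j} = {i..j}" by (simp add: image_image)
    with x[of "?x ` {i..j}"] have "bij_betw ?x (?x ` {i..j}) {i..j}" by simp
    from bij_betw_trans[OF bij_betw_trans[OF this permutes_imp_bij[OF u]] x]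
    show ?thesis by (simp only: o_assoc)
  qed
  have fix_out: "(?x \<circ> u \<circ> ?x) t = t" if "t \<notin> ?x ` {i..j}" for t
  proof -
    have "?x t \<notin> {i..j}" using that by (metis block_swap_inverse imageI)
    then show ?thesis using permutes_not_in[OF u, of "?x t"] by simp
  qed
  { assume ij: "1 \<le> i" "j \<le> n"
    have "?x ` {i..j} = (\<lambda>t. t + n) ` {i..j}"
      using ij by (intro image_cong refl half_swap_apply(1)) auto
    then have "?x ` {i..j} = {n + i..n + j}" by (simp add: add.commute)
    then show "?x \<circ> u \<circ> ?x permutes {n + i..n + j}"
      using bij_imp_permutes[OF bij fix_out] by metis }
  { assume ij: "n + 1 \<le> i" "j \<le> 2 * n"
    have "?x ` {i..j} = (\<lambda>t. t - n) ` {i..j}"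
      using ij by (intro image_cong refl half_swap_apply(2)) auto
    also have "\<dots> = {i - n..j - n}"
    proof
      show "{i - n..j - n} \<subseteq> (\<lambda>t. t - n) ` {i..j}"
      proof
        fix t assume "t \<in> {i - n..j - n}"
        then show "t \<in> (\<lambda>t. t - n) ` {i..j}" using ij by (intro image_eqI[of _ _ "t + n"]) auto
      qed
    qed (use ij in auto)
    finally show "?x \<circ> u \<circ> ?x permutes {i - n..j - n}"
      using bij_imp_permutes[OF bij fix_out] by metis }
qed

text \<open>Inversions of \<open>u\<close> lie within the first half, those of
  \<open>x \<circ> u \<circ> x\<close> within the second, and those of \<open>x\<close> join the
  halves. As \<open>x\<close> keeps the order inside each half, none of the four products undoes an
  inversion.\<close>

lemma braid_lift_half_swap:
  assumes u: "u permutes {1..n}"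
  defines "x \<equiv> block_swap 0 n n"
  shows "braid_lift (2 * n) x \<otimes>\<^bsub>braid_monoid (2 * n)\<^esub> braid_lift (2 * n) u =
      braid_lift (2 * n) (x \<circ> u \<circ> x) \<otimes>\<^bsub>braid_monoid (2 * n)\<^esub> braid_lift (2 * n) x"
    and "braid_lift (2 * n) x \<otimes>\<^bsub>braid_monoid (2 * n)\<^esub> braid_lift (2 * n) (x \<circ> u \<circ> x) =
      braid_lift (2 * n) u \<otimes>\<^bsub>braid_monoid (2 * n)\<^esub> braid_lift (2 * n) x"
proof -
  note p = permutes_interval_apply[OF u]
  have xx [simp]: "x (x t) = t" for t by (simp add: x_def)
  have x_low: "x t = t + n" if "1 \<le> t" "t \<le> n" for t using that by (simp add: x_def block_swap_def)
  have x_high: "x t = t - n" if "n < t" "t \<le> 2 * n" for t using that by (simp add: x_def block_swap_def)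
  let ?c = "x \<circ> u \<circ> x"
  have ci: "?c permutes {n + 1..2 * n}" using half_swap_conj_permutes(1)[OF u, of n] by (simp add: x_def mult_2)
  have P: "u permutes {1..2 * n}" "x permutes {1..2 * n}" "?c permutes {1..2 * n}"
    using permutes_interval_mono[OF u] block_swap_permutes[of 0 n n] permutes_interval_mono[OF ci]
    by (auto simp: x_def mult_2)
  have inv_x: "inversions x = {(s, t). 1 \<le> s \<and> s \<le> n \<and> n < t \<and> t \<le> 2 * n}"
    unfolding x_def inversions_block_swap by auto
  have 1: "inversions u \<subseteq> inversions (x \<circ> u)"
  proof
    fix y assume y: "y \<in> inversions u"
    then obtain a b where ab: "y = (a, b)" "1 \<le> a" "a < b" "b \<le> n"
      using inversions_permutes_interval[OF u] by blast
    then have "x (u a) = u a + n" "x (u b) = u b + n" by (auto intro!: x_low p(1,2))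
    with y ab show "y \<in> inversions (x \<circ> u)" by (simp add: inversions_def)
  qed
  have 2: "inversions x \<subseteq> inversions (x \<circ> u)"
  proof
    fix y assume "y \<in> inversions x"
    then obtain a b where ab: "y = (a, b)" "1 \<le> a" "a \<le> n" "n < b" "b \<le> 2 * n"
      unfolding inv_x by blast
    then have "x (u a) = u a + n" "u b = b" "x b = b - n" by (auto intro!: x_low x_high p)
    with ab show "y \<in> inversions (x \<circ> u)" using p(1)[of a] by (auto simp: inversions_def)
  qed
  have 3: "inversions ?c \<subseteq> inversions (u \<circ> x)"
  proof
    fix y assume y: "y \<in> inversions ?c"
    then obtain a b where ab: "y = (a, b)" "n < a" "a < b" "b \<le> 2 * n"
      using inversions_permutes_interval[OF ci] by fastforce
    then have "x a = a - n" "x b = b - n" by (auto intro!: x_high)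
    then have "x (u (x a)) = u (x a) + n" "x (u (x b)) = u (x b) + n"
      using ab by (auto intro!: x_low p(1,2))
    with y ab show "y \<in> inversions (u \<circ> x)" by (simp add: inversions_def)
  qed
  have 4: "inversions x \<subseteq> inversions (u \<circ> x)"
  proof
    fix y assume "y \<in> inversions x"
    then obtain a b where ab: "y = (a, b)" "1 \<le> a" "a \<le> n" "n < b" "b \<le> 2 * n"
      unfolding inv_x by blast
    then have "x a = a + n" "x b = b - n" "u (a + n) = a + n" by (auto intro!: x_low x_high p)
    moreover have "u (b - n) \<le> n" using ab by (intro p(2)) auto
    ultimately show "y \<in> inversions (u \<circ> x)" using ab by (simp add: inversions_def)
  qed
  have e: "?c \<circ> x = x \<circ> u" "x \<circ> ?c = u \<circ> x" by (simp_all add: fun_eq_iff)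
  show "braid_lift (2 * n) x \<otimes>\<^bsub>braid_monoid (2 * n)\<^esub> braid_lift (2 * n) u =
      braid_lift (2 * n) ?c \<otimes>\<^bsub>braid_monoid (2 * n)\<^esub> braid_lift (2 * n) x"
    using braid_lift_mult[OF P(2,1) 1] braid_lift_mult[OF P(3,2)] 2 by (simp only: e)
  show "braid_lift (2 * n) x \<otimes>\<^bsub>braid_monoid (2 * n)\<^esub> braid_lift (2 * n) ?c =
      braid_lift (2 * n) u \<otimes>\<^bsub>braid_monoid (2 * n)\<^esub> braid_lift (2 * n) x"
    using braid_lift_mult[OF P(2,3)] braid_lift_mult[OF P(1,2) 4] 3 by (simp only: e)
qed


section \<open>Homomorphisms out of a presented monoid\<close>

lemma (in monoid) word_prod_closed: "set xs \<subseteq> carrier G \<Longrightarrow> word_prod G xs \<in> carrier G"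
  by (induction xs) (simp_all add: word_prod_def)

lemma (in monoid) word_prod_append:
  "set xs \<subseteq> carrier G \<Longrightarrow> set ys \<subseteq> carrier G \<Longrightarrow>
    word_prod G (xs @ ys) = word_prod G xs \<otimes> word_prod G ys"
proof (induction xs)
  case (Cons x xs)
  then show ?case using word_prod_closed[of xs] word_prod_closed[of ys]
    by (simp add: word_prod_def m_assoc)
qed (use word_prod_closed[of ys] in \<open>simp add: word_prod_def\<close>)

lemma (in monoid) word_prod_cong:
  assumes "(u, v) \<in> pres_cong S R" and f: "f ` S \<subseteq> carrier G"
    and R: "\<And>l r. (l, r) \<in> R \<Longrightarrow> word_prod G (map f l) = word_prod G (map f r)"
  shows "word_prod G (map f u) = word_prod G (map f v)"
  using assms(1)
proof (induction rule: pres_cong.induct)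
  case (rel l r x y)
  have c: "set (map f z) \<subseteq> carrier G" if "z \<in> lists S" for z using f that by auto
  show ?case
    using R[OF rel.hyps(1)] c rel.hyps by (simp add: word_prod_append del: set_map)
qed simp_all

text \<open>The universal property of a presentation. Membership in \<open>hom\<close> only concerns
  products, so the unit is a separate clause; extensionality fixes the values off the carrier, as
  uniqueness requires.\<close>

lemma (in monoid) ex1_hom_pres_monoid:
  assumes f: "f ` S \<subseteq> carrier G"
    and R: "\<And>l r. (l, r) \<in> R \<Longrightarrow> word_prod G (map f l) = word_prod G (map f r)"
  shows "\<exists>!\<phi>. \<phi> \<in> hom (pres_monoid S R) G \<inter> extensional (carrier (pres_monoid S R))
    \<and> \<phi> \<one>\<^bsub>pres_monoid S R\<^esub> = \<one> \<and> (\<forall>s\<in>S. \<phi> (pres_gen S R s) = f s)"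
proof (rule ex1I)
  let ?M = "pres_monoid S R" and ?w = "\<lambda>u. word_prod G (map f u)"
  have c: "set (map f z) \<subseteq> carrier G" if "z \<in> lists S" for z using f that by auto
  \<comment> \<open>The value is computed on an arbitrary representative;
    \<open>word_prod_cong\<close> makes it independent of the choice.\<close>
  define \<phi> where "\<phi> = restrict (\<lambda>A. ?w (SOME u. u \<in> A)) (carrier ?M)"
  have \<phi>: "\<phi> (pres_class S R u) = ?w u" if u: "u \<in> lists S" for u
  proof -
    have "u \<in> pres_class S R u" using u by (simp add: pres_class_def pres_cong.refl)
    then have "(SOME v. v \<in> pres_class S R u) \<in> pres_class S R u" by (rule someI)
    then have "(u, SOME v. v \<in> pres_class S R u) \<in> pres_cong S R" by (simp add: pres_class_def)
    then have "?w u = ?w (SOME v. v \<in> pres_class S R u)" by (rule word_prod_cong[OF _ f]) (rule R)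
    moreover have "pres_class S R u \<in> carrier ?M" using u by (simp add: pres_carrier)
    ultimately show ?thesis by (simp add: \<phi>_def)
  qed
  have "\<phi> \<in> hom ?M G"
  proof (rule homI)
    fix A assume "A \<in> carrier ?M"
    then obtain u where "u \<in> lists S" "A = pres_class S R u" by (auto simp: pres_carrier)
    then show "\<phi> A \<in> carrier G" using \<phi> word_prod_closed c by simp
  next
    fix A B assume "A \<in> carrier ?M" "B \<in> carrier ?M"
    then obtain u v where "u \<in> lists S" "A = pres_class S R u" "v \<in> lists S" "B = pres_class S R v"
      by (auto simp: pres_carrier)
    then show "\<phi> (A \<otimes>\<^bsub>?M\<^esub> B) = \<phi> A \<otimes> \<phi> B"
      using \<phi>[of u] \<phi>[of v] \<phi>[of "u @ v"] pres_mult[of u S v R] word_prod_append[OF c c, of u v] by simp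
  qed
  moreover have "\<phi> \<one>\<^bsub>?M\<^esub> = \<one>" using \<phi>[of "[]"] by (simp add: pres_one word_prod_def)
  moreover have "\<phi> (pres_gen S R s) = f s" if "s \<in> S" for s
    using \<phi>[of "[s]"] that f by (auto simp: pres_gen_def word_prod_def)
  ultimately show "\<phi> \<in> hom ?M G \<inter> extensional (carrier ?M)
    \<and> \<phi> \<one>\<^bsub>?M\<^esub> = \<one> \<and> (\<forall>s\<in>S. \<phi> (pres_gen S R s) = f s)"
    by (simp add: \<phi>_def)
  fix \<psi> assume \<psi>: "\<psi> \<in> hom ?M G \<inter> extensional (carrier ?M)
    \<and> \<psi> \<one>\<^bsub>?M\<^esub> = \<one> \<and> (\<forall>s\<in>S. \<psi> (pres_gen S R s) = f s)"
  have "\<psi> (pres_class S R u) = ?w u" if "u \<in> lists S" for u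
    using that
  proof (induction u)
    case Nil
    then show ?case using \<psi> by (simp add: pres_one[symmetric] word_prod_def)
  next
    case (Cons s u)
    have "pres_class S R (s # u) = pres_class S R [s] \<otimes>\<^bsub>?M\<^esub> pres_class S R u"
      using pres_mult[of "[s]" S u R] Cons.hyps by simp
    moreover have "pres_class S R [s] \<in> carrier ?M" "pres_class S R u \<in> carrier ?M"
      using Cons.hyps by (auto simp: pres_carrier)
    ultimately have "\<psi> (pres_class S R (s # u)) = \<psi> (pres_class S R [s]) \<otimes> \<psi> (pres_class S R u)"
      using \<psi> by (simp add: hom_mult)
    then show ?case using \<psi> Cons by (simp add: pres_gen_def word_prod_def)
  qed
  then have "\<psi> A = \<phi> A" if "A \<in> carrier ?M" for A
    using that \<phi> unfolding pres_carrier by fastforce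
  moreover have "\<psi> \<in> extensional (carrier ?M)" "\<phi> \<in> extensional (carrier ?M)"
    using \<psi> by (simp_all add: \<phi>_def)
  ultimately show "\<psi> = \<phi>" by (rule extensionalityI[rotated 2])
qed


section \<open>The relation of type B2\<close>

text \<open>Membership in the carrier is included so that commutation rules can be chained without
  side conditions.\<close>

definition commuting :: "('a, 'b) monoid_scheme \<Rightarrow> 'a \<Rightarrow> 'a \<Rightarrow> bool" where
  "commuting G u v \<longleftrightarrow> u \<in> carrier G \<and> v \<in> carrier G \<and> u \<otimes>\<^bsub>G\<^esub> v = v \<otimes>\<^bsub>G\<^esub> u"

lemma commuting_sym: "commuting G u v \<Longrightarrow> commuting G v u"
  by (simp add: commuting_def)

lemma (in monoid) commuting_mult:
  assumes "commuting G u v" "commuting G u w" shows "commuting G u (v \<otimes> w)"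
  unfolding commuting_def using assms by (metis commuting_def m_assoc m_closed)

lemma (in monoid) commuting_mult_left:
  "commuting G u w \<Longrightarrow> commuting G v w \<Longrightarrow> commuting G (u \<otimes> v) w"
  by (blast intro: commuting_sym commuting_mult)

text \<open>With \<open>A = y g' Z\<^sub>1 = Z\<^sub>4 y g'\<close> and \<open>B = Z\<^sub>2 y' h = y' h Z\<^sub>3\<close>, pulling \<open>Z\<close> to the
  right gives \<open>AB = y y g' h' Z\<close> and \<open>BA = y' y' g h Z\<close>; these two prefixes commute and are
  exchanged by \<open>Z\<close>.\<close>

lemma (in monoid) B2_relation:
  assumes carr: "y \<in> carrier G" "y' \<in> carrier G" "g \<in> carrier G" "g' \<in> carrier G" "h \<in> carrier G"
      "h' \<in> carrier G" "Z \<in> carrier G" "Z1 \<in> carrier G" "Z2 \<in> carrier G" "Z3 \<in> carrier G" "Z4 \<in> carrier G"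
    and A: "A = y \<otimes> g' \<otimes> Z1" "A = Z4 \<otimes> (y \<otimes> g')"
    and B: "B = Z2 \<otimes> (y' \<otimes> h)" "B = y' \<otimes> h \<otimes> Z3"
    and ZZ: "Z1 \<otimes> Z2 = Z" "Z3 \<otimes> Z4 = Z"
    and Z: "Z \<otimes> y = y' \<otimes> Z" "Z \<otimes> y' = y \<otimes> Z" "Z \<otimes> g = g' \<otimes> Z" "Z \<otimes> g' = g \<otimes> Z"
      "Z \<otimes> h = h' \<otimes> Z" "Z \<otimes> h' = h \<otimes> Z"
    and c1: "commuting G y y'" "commuting G y g'" "commuting G y h'" "commuting G y' g" "commuting G y' h"
    and c2: "commuting G g g'" "commuting G g h'" "commuting G h g'" "commuting G h h'"
    and c3: "commuting G g h"
    and c4: "commuting G (y \<otimes> y) g" "commuting G (y \<otimes> y) h"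
      "commuting G (y' \<otimes> y') g'" "commuting G (y' \<otimes> y') h'"
  shows "A \<otimes> B \<otimes> A \<otimes> B = B \<otimes> A \<otimes> B \<otimes> A"
proof -
  note [simp] = carr
  have Z_mult: "Z \<otimes> (a \<otimes> b) = a' \<otimes> b' \<otimes> Z"
    if "Z \<otimes> a = a' \<otimes> Z" "Z \<otimes> b = b' \<otimes> Z"
      and "a \<in> carrier G" "b \<in> carrier G" "a' \<in> carrier G" "b' \<in> carrier G" for a b a' b'
  proof -
    have "Z \<otimes> (a \<otimes> b) = a' \<otimes> (Z \<otimes> b)" using that by (metis carr(7) m_assoc)
    then show ?thesis using that by (simp add: m_assoc)
  qed
  define p where "p = y \<otimes> y \<otimes> (g' \<otimes> h')"
  define q where "q = y' \<otimes> y' \<otimes> (g \<otimes> h)"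
  have pq [simp]: "p \<in> carrier G" "q \<in> carrier G" by (simp_all add: p_def q_def)
  have "A \<otimes> B = y \<otimes> g' \<otimes> (Z1 \<otimes> Z2) \<otimes> (y' \<otimes> h)" by (simp add: A(1) B(1) m_assoc)
  also have "\<dots> = y \<otimes> g' \<otimes> (Z \<otimes> (y' \<otimes> h))" by (simp add: ZZ m_assoc)
  also have "Z \<otimes> (y' \<otimes> h) = y \<otimes> h' \<otimes> Z" by (rule Z_mult) (simp_all add: Z)
  also have "y \<otimes> g' \<otimes> (y \<otimes> h' \<otimes> Z) = y \<otimes> (g' \<otimes> y) \<otimes> (h' \<otimes> Z)" by (simp add: m_assoc)
  also have "g' \<otimes> y = y \<otimes> g'" using c1(2) by (simp add: commuting_def)
  finally have AB: "A \<otimes> B = p \<otimes> Z" by (simp add: p_def m_assoc)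
  have "B \<otimes> A = y' \<otimes> h \<otimes> (Z3 \<otimes> Z4) \<otimes> (y \<otimes> g')" by (simp add: A(2) B(2) m_assoc)
  also have "\<dots> = y' \<otimes> h \<otimes> (Z \<otimes> (y \<otimes> g'))" by (simp add: ZZ m_assoc)
  also have "Z \<otimes> (y \<otimes> g') = y' \<otimes> g \<otimes> Z" by (rule Z_mult) (simp_all add: Z)
  also have "y' \<otimes> h \<otimes> (y' \<otimes> g \<otimes> Z) = y' \<otimes> (h \<otimes> y') \<otimes> (g \<otimes> Z)" by (simp add: m_assoc)
  also have "h \<otimes> y' = y' \<otimes> h" using c1(5) by (simp add: commuting_def)
  also have "y' \<otimes> (y' \<otimes> h) \<otimes> (g \<otimes> Z) = y' \<otimes> y' \<otimes> (h \<otimes> g) \<otimes> Z" by (simp add: m_assoc)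
  also have "h \<otimes> g = g \<otimes> h" using c3 by (simp add: commuting_def)
  finally have BA: "B \<otimes> A = q \<otimes> Z" by (simp add: q_def)
  have Zp: "Z \<otimes> p = q \<otimes> Z" unfolding p_def q_def
    by (intro Z_mult) (simp_all add: Z)
  have Zq: "Z \<otimes> q = p \<otimes> Z" unfolding p_def q_def
    by (intro Z_mult) (simp_all add: Z)
  have "commuting G (y \<otimes> y) (y' \<otimes> y')"
    by (intro commuting_mult commuting_mult_left c1)
  moreover have "commuting G (y \<otimes> y) (g \<otimes> h)"
    by (intro commuting_mult c4)
  moreover have "commuting G (g' \<otimes> h') (y' \<otimes> y')"
    by (rule commuting_mult_left; rule c4[THEN commuting_sym])
  moreover have "commuting G (g' \<otimes> h') (g \<otimes> h)"
    by (intro commuting_mult commuting_mult_left; rule c2[THEN commuting_sym])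
  ultimately have "commuting G p q" unfolding p_def q_def
    by - (rule commuting_mult_left; rule commuting_mult; assumption)
  then have "p \<otimes> q = q \<otimes> p" by (simp add: commuting_def)
  have "A \<otimes> B \<otimes> A \<otimes> B = A \<otimes> B \<otimes> (A \<otimes> B)"
    by (simp add: A(1) B(1) m_assoc)
  \<comment> \<open>The computation is \<open>p Z p Z = p q Z Z = q p Z Z = q Z q Z\<close>.\<close>
  also have "\<dots> = p \<otimes> (Z \<otimes> p) \<otimes> Z" unfolding AB by (simp add: m_assoc)
  also have "\<dots> = q \<otimes> p \<otimes> Z \<otimes> Z" unfolding Zp \<open>p \<otimes> q = q \<otimes> p\<close>[symmetric] by (simp add: m_assoc)
  also have "\<dots> = q \<otimes> (Z \<otimes> q) \<otimes> Z" unfolding Zq by (simp add: m_assoc)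
  also have "\<dots> = B \<otimes> A \<otimes> (B \<otimes> A)" unfolding BA by (simp add: m_assoc)
  also have "\<dots> = B \<otimes> A \<otimes> B \<otimes> A" by (simp add: A(1) B(1) m_assoc)
  finally show ?thesis .
qed

section \<open>Commutation of lifted permutations\<close>

lemma commuting_separated:
  fixes u v :: "nat \<Rightarrow> nat"
  assumes "u permutes {i..c}" "v permutes {d..j}" "c < d" "1 \<le> i" "c \<le> N" "1 \<le> d" "j \<le> N"
  shows "commuting (braid_monoid N) (braid_lift N u) (braid_lift N v)"
proof -
  have "u permutes {1..N}" "v permutes {1..N}"
    using assms permutes_interval_mono[OF assms(1), of 1 N] permutes_interval_mono[OF assms(2), of 1 N]
    by auto
  then show ?thesis unfolding commuting_def
    using braid_lift_closed braid_lift_separated[OF assms] by simp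
qed

text \<open>The reversal inverts every pair in its interval, so \<open>braid_lift_conj\<close>
  applies to each involution supported there.\<close>

lemma braid_lift_reversal_conj:
  assumes u: "u permutes {i..j}" "u \<circ> u = id" and ij: "1 \<le> i" "j \<le> N"
  shows "braid_lift N (reversal i j) \<otimes>\<^bsub>braid_monoid N\<^esub> braid_lift N u =
    braid_lift N (reversal i j \<circ> u \<circ> reversal i j) \<otimes>\<^bsub>braid_monoid N\<^esub> braid_lift N (reversal i j)"
proof (rule braid_lift_conj)
  have p: "reversal i j \<circ> u \<circ> reversal i j permutes {i..j}"
    by (intro permutes_compose reversal_permutes u)
  show "inversions (reversal i j \<circ> u \<circ> reversal i j) \<subseteq> inversions (reversal i j)"
    unfolding inversions_reversal by (rule inversions_permutes_interval[OF p])
  show "inversions u \<subseteq> inversions (reversal i j)"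
    unfolding inversions_reversal by (rule inversions_permutes_interval[OF u(1)])
qed (use u ij permutes_interval_mono[OF reversal_permutes] permutes_interval_mono reversal_involution
    in blast)+

lemma commuting_reversal:
  assumes "u permutes {i..j}" "u \<circ> u = id" "1 \<le> i" "j \<le> N"
    and "reversal i j \<circ> u \<circ> reversal i j = u"
  shows "commuting (braid_monoid N) (braid_lift N (reversal i j)) (braid_lift N u)"
  using braid_lift_reversal_conj[OF assms(1-4)] assms permutes_interval_mono[OF assms(1), of 1 N]
    permutes_interval_mono[OF reversal_permutes, of 1 i j N]
  by (simp add: commuting_def braid_lift_closed)

text \<open>The full twist is the square of the half twist. Passing \<open>u\<close> through one
  half twist gives its flip \<open>?v\<close>, and the second half twist turns \<open>?v\<close>
  back into \<open>u\<close>.\<close>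

lemma commuting_reversal_square:
  assumes u: "u permutes {i..j}" "u \<circ> u = id" and ij: "1 \<le> i" "j \<le> N"
  shows "commuting (braid_monoid N)
    (braid_lift N (reversal i j) \<otimes>\<^bsub>braid_monoid N\<^esub> braid_lift N (reversal i j)) (braid_lift N u)"
proof -
  interpret monoid "braid_monoid N" unfolding braid_monoid_def by (rule monoid_pres_monoid)
  let ?r = "reversal i j" let ?v = "?r \<circ> u \<circ> ?r"
  have v: "?v permutes {i..j}" by (intro permutes_compose reversal_permutes u)
  have vv: "?v \<circ> ?v = id" "?r \<circ> ?v \<circ> ?r = u"
    using involution_apply[OF u(2)] by (simp_all add: fun_eq_iff)
  have "?r permutes {1..N}" "u permutes {1..N}" "?v permutes {1..N}"
    using reversal_permutes u(1) v ij by (blast intro: permutes_interval_mono)+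
  then have c: "braid_lift N ?r \<in> carrier (braid_monoid N)" "braid_lift N u \<in> carrier (braid_monoid N)"
    "braid_lift N ?v \<in> carrier (braid_monoid N)"
    by (simp_all add: braid_lift_closed)
  have 1: "braid_lift N ?r \<otimes>\<^bsub>braid_monoid N\<^esub> braid_lift N u = braid_lift N ?v \<otimes>\<^bsub>braid_monoid N\<^esub> braid_lift N ?r"
    using braid_lift_reversal_conj[OF u ij] .
  have 2: "braid_lift N ?r \<otimes>\<^bsub>braid_monoid N\<^esub> braid_lift N ?v = braid_lift N u \<otimes>\<^bsub>braid_monoid N\<^esub> braid_lift N ?r"
    using braid_lift_reversal_conj[OF v vv(1) ij] unfolding vv(2) .
  show ?thesis unfolding commuting_def using c 1 2 by (metis m_assoc m_closed)
qed

text \<open>The set \<open>J\<close> belongs to the first cable, on strands \<open>1\<close> to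
  \<open>p\<close>, and \<open>K\<close> to the last, on strands \<open>n + p + 1\<close> to
  \<open>2 * n\<close>. Both reflections have the form \<open>i + j - 1 - t\<close> for these end
  points, as in \<open>reversal_longest_elt\<close>.\<close>

lemma B2_relation_braid:
  fixes p q n :: nat and J K :: "nat set"
  assumes n: "n = p + q" and pos: "1 \<le> p"
    and J: "J \<subseteq> {1..<p}" "J = (\<lambda>t. 1 + p - 1 - t) ` J"
    and K: "K \<subseteq> {n + p + 1..<2 * n}" "K = (\<lambda>t. n + p + 1 + 2 * n - 1 - t) ` K"
  defines "A \<equiv> braid_lift (2 * n) (longest_elt (2 * n) ({1..<n + p} \<union> K))"
    and "B \<equiv> braid_lift (2 * n) (longest_elt (2 * n) ({p + 1..<2 * n} \<union> J))"
    and "M \<equiv> braid_monoid (2 * n)"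
  shows "A \<otimes>\<^bsub>M\<^esub> B \<otimes>\<^bsub>M\<^esub> A \<otimes>\<^bsub>M\<^esub> B = B \<otimes>\<^bsub>M\<^esub> A \<otimes>\<^bsub>M\<^esub> B \<otimes>\<^bsub>M\<^esub> A"
proof -
  interpret monoid M unfolding M_def braid_monoid_def by (rule monoid_pres_monoid)
  let ?T = "braid_lift (2 * n)"
  define x where "x = block_swap 0 n n"
  define j where "j = longest_elt (2 * n) J"
  define k' where "k' = longest_elt (2 * n) K"
  \<comment> \<open>Primes mark the second half. Since \<open>K\<close> sits there,
    \<open>k'\<close> is the given longest element and \<open>k\<close> its translate, whereas
    \<open>j\<close> is given and \<open>j'\<close> is the translate.\<close>
  define j' where "j' = x \<circ> j \<circ> x"
  define k where "k = x \<circ> k' \<circ> x"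
  have xx [simp]: "x (x t) = t" for t by (simp add: x_def)
  have pj: "j permutes {1..p}" unfolding j_def
    using J n by (intro permutes_longest_elt_interval) auto
  have pk': "k' permutes {n + p + 1..2 * n}" unfolding k'_def
    using K n by (intro permutes_longest_elt_interval) auto
  have pj': "j' permutes {n + 1..n + p}"
    using half_swap_conj_permutes(1)[OF pj, of n] n by (simp add: j'_def x_def)
  have pk: "k permutes {p + 1..n}"
    using half_swap_conj_permutes(2)[OF pk', of n] n by (simp add: k_def x_def mult_2)
  have jj: "j \<circ> j = id" unfolding j_def using J n by (intro longest_elt_involution) auto
  have kk': "k' \<circ> k' = id" unfolding k'_def using K n by (intro longest_elt_involution) auto
  have jj': "j' \<circ> j' = id" and kk: "k \<circ> k = id"
    using involution_apply[OF jj] involution_apply[OF kk'] by (simp_all add: j'_def k_def fun_eq_iff)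
  have k'_eq: "k' = x \<circ> k \<circ> x" by (simp add: k_def fun_eq_iff)
  have rev_shift: "reversal (n + a) (n + b) = x \<circ> reversal a b \<circ> x" if "1 \<le> a" "b \<le> n" for a b
  proof
    fix t
    consider "t = 0" | "1 \<le> t" "t \<le> n" | "n < t" "t \<le> 2 * n" | "2 * n < t" by linarith
    then show "reversal (n + a) (n + b) t = (x \<circ> reversal a b \<circ> x) t"
      by cases (use that in \<open>auto simp: reversal_def x_def block_swap_def\<close>)
  qed
  have rj: "reversal 1 p \<circ> j \<circ> reversal 1 p = j"
    unfolding j_def using J n by (intro reversal_longest_elt) auto
  have rk': "reversal (n + p + 1) (2 * n) \<circ> k' \<circ> reversal (n + p + 1) (2 * n) = k'"
    unfolding k'_def using K n by (intro reversal_longest_elt) auto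
  have rP': "reversal (n + 1) (n + p) = x \<circ> reversal 1 p \<circ> x" using n by (intro rev_shift) auto
  have rQ': "reversal (n + p + 1) (2 * n) = x \<circ> reversal (p + 1) n \<circ> x"
    using rev_shift[of "p + 1" n] by (simp add: mult_2 add.assoc)
  have rY': "reversal (n + 1) (2 * n) = x \<circ> reversal 1 n \<circ> x"
    using rev_shift[of 1 n] by (simp add: mult_2)
  \<comment> \<open>The symmetry of \<open>K\<close>, known for the last cable by
    \<open>rk'\<close>, is carried to the second cable by conjugation with \<open>x\<close>.\<close>
  have rk: "reversal (p + 1) n \<circ> k \<circ> reversal (p + 1) n = k"
  proof
    fix t
    have "(reversal (n + p + 1) (2 * n) \<circ> k' \<circ> reversal (n + p + 1) (2 * n)) (x t) = k' (x t)"
      by (simp only: rk')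
    then have "x (reversal (p + 1) n (x (k' (x (reversal (p + 1) n t))))) = k' (x t)"
      unfolding rQ' by simp
    then have "reversal (p + 1) n (x (k' (x (reversal (p + 1) n t)))) = x (k' (x t))"
      by (metis xx)
    then show "(reversal (p + 1) n \<circ> k \<circ> reversal (p + 1) n) t = k t" by (simp add: k_def)
  qed
  define Y Y' P P' Q Q' where defs: "Y = ?T (reversal 1 n)" "Y' = ?T (reversal (n + 1) (2 * n))"
    "P = ?T (reversal 1 p)" "P' = ?T (reversal (n + 1) (n + p))"
    "Q = ?T (reversal (p + 1) n)" "Q' = ?T (reversal (n + p + 1) (2 * n))"
  define Z1 Z2 Z3 Z4 Z where zdefs: "Z1 = ?T (block_swap 0 p n)" "Z2 = ?T (block_swap p q n)"
    "Z3 = ?T (block_swap p n q)" "Z4 = ?T (block_swap 0 n p)" "Z = ?T x"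
  have le: "p \<le> n" "p + q + n \<le> 2 * n" "p + n + q \<le> 2 * n" "n + p \<le> 2 * n" using n by simp_all
  note closed = braid_lift_closed[where N = "2 * n", folded M_def]
  have carr: "Y \<in> carrier M" "Y' \<in> carrier M" "P \<in> carrier M" "P' \<in> carrier M" "Q \<in> carrier M"
    "Q' \<in> carrier M"
    unfolding defs using le by (auto intro!: closed permutes_interval_mono[OF reversal_permutes])
  have zcarr: "Z1 \<in> carrier M" "Z2 \<in> carrier M" "Z3 \<in> carrier M" "Z4 \<in> carrier M" "Z \<in> carrier M"
    unfolding zdefs x_def using le by (auto intro!: closed permutes_interval_mono[OF block_swap_permutes])
  have jcarr: "?T j \<in> carrier M" "?T j' \<in> carrier M" "?T k \<in> carrier M" "?T k' \<in> carrier M"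
    using le by (auto intro!: closed permutes_interval_mono[OF pj] permutes_interval_mono[OF pj']
        permutes_interval_mono[OF pk] permutes_interval_mono[OF pk'])
  note [simp] = carr zcarr jcarr

  note sep = commuting_separated[where N = "2 * n", folded M_def]
  note rp = reversal_permutes
  note comm_sq = commuting_reversal_square[where N = "2 * n", folded M_def]
  have low: "reversal 1 p permutes {1..n}" "reversal (p + 1) n permutes {1..n}" "reversal 1 n permutes {1..n}"
      "j permutes {1..n}" "k permutes {1..n}"
    using le by (auto intro!: permutes_interval_mono[OF rp] permutes_interval_mono[OF pj] permutes_interval_mono[OF pk])
  have high: "reversal (n + 1) (n + p) permutes {n + 1..2 * n}" "reversal (n + p + 1) (2 * n) permutes {n + 1..2 * n}"
      "reversal (n + 1) (2 * n) permutes {n + 1..2 * n}" "j' permutes {n + 1..2 * n}" "k' permutes {n + 1..2 * n}"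
    using le by (auto intro!: permutes_interval_mono[OF rp] permutes_interval_mono[OF pj'] permutes_interval_mono[OF pk'])
  have low_high: "commuting M (?T u) (?T v)" if "u permutes {1..n}" "v permutes {n + 1..2 * n}" for u v
    using that by (rule sep) auto
  have PJ: "commuting M P (?T j)" unfolding defs M_def
    using le by (intro commuting_reversal pj jj rj) auto
  have QK: "commuting M Q (?T k)" unfolding defs M_def
    using le by (intro commuting_reversal pk kk rk) auto
  have shift: "Z \<otimes>\<^bsub>M\<^esub> ?T u = ?T (x \<circ> u \<circ> x) \<otimes>\<^bsub>M\<^esub> Z" "Z \<otimes>\<^bsub>M\<^esub> ?T (x \<circ> u \<circ> x) = ?T u \<otimes>\<^bsub>M\<^esub> Z"
    if "u permutes {1..n}" for u
    using braid_lift_half_swap[OF that] unfolding zdefs x_def M_def by simp_all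

  have T_A: "A = ?T (reversal 1 (n + p)) \<otimes>\<^bsub>M\<^esub> ?T k'"
  proof -
    have "longest_elt (2 * n) ({1..<n + p} \<union> K) = reversal 1 (n + p) \<circ> k'"
      unfolding k'_def using K n longest_elt_Un[of "{1..<n + p}" 1 "n + p" K "n + p + 1" "2 * n" "2 * n"]
        longest_elt_interval[of 1 "n + p" "2 * n"] by simp
    moreover have "?T (reversal 1 (n + p)) \<otimes>\<^bsub>M\<^esub> ?T k' = ?T (reversal 1 (n + p) \<circ> k')"
      unfolding M_def by (rule braid_lift_separated(1)[OF rp pk']) (use le in auto)
    ultimately show ?thesis unfolding A_def by simp
  qed
  have T_B: "B = ?T (reversal (p + 1) (2 * n)) \<otimes>\<^bsub>M\<^esub> ?T j"
  proof -
    have "longest_elt (2 * n) ({p + 1..<2 * n} \<union> J) = j \<circ> reversal (p + 1) (2 * n)"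
      unfolding j_def using J n longest_elt_Un[of J 1 p "{p + 1..<2 * n}" "p + 1" "2 * n" "2 * n"]
        longest_elt_interval[of "p + 1" "2 * n" "2 * n"] by (simp add: Un_commute)
    moreover have "?T (reversal (p + 1) (2 * n)) \<otimes>\<^bsub>M\<^esub> ?T j = ?T (j \<circ> reversal (p + 1) (2 * n))"
      unfolding M_def by (rule braid_lift_separated(2)[OF pj rp]) (use le in auto)
    ultimately show ?thesis unfolding B_def by simp
  qed
  \<comment> \<open>The strands \<open>1\<close> to \<open>n + p\<close> are cut as \<open>p\<close>
    then \<open>n\<close> here, with the swap acting first, and as \<open>n\<close> then
    \<open>p\<close> in \<open>A_right\<close>, with the swap acting last. Either way the twists are
    on \<open>1\<close> to \<open>n\<close> and on \<open>n + 1\<close> to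
    \<open>n + p\<close>.\<close>
  have A_left: "?T (reversal 1 (n + p)) = Y \<otimes>\<^bsub>M\<^esub> P' \<otimes>\<^bsub>M\<^esub> Z1"
    using braid_lift_reversal_left[of 0 p n "2 * n"] le by (simp add: defs zdefs M_def add.commute)
  have A_right: "?T (reversal 1 (n + p)) = Z4 \<otimes>\<^bsub>M\<^esub> (Y \<otimes>\<^bsub>M\<^esub> P')"
    using braid_lift_reversal_right[of 0 n p "2 * n"] le by (simp add: defs zdefs M_def)
  have pq: "p + q = n" and pqn: "p + q + n = 2 * n" "p + n + q = 2 * n" using n by simp_all
  have B_left: "?T (reversal (p + 1) (2 * n)) = Q \<otimes>\<^bsub>M\<^esub> Y' \<otimes>\<^bsub>M\<^esub> Z3"
    using braid_lift_reversal_left[of p n q "2 * n", unfolded pqn, unfolded pq] by (simp add: defs zdefs M_def)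
  have B_right: "?T (reversal (p + 1) (2 * n)) = Z2 \<otimes>\<^bsub>M\<^esub> (Q \<otimes>\<^bsub>M\<^esub> Y')"
    using braid_lift_reversal_right[of p q n "2 * n", unfolded pqn, unfolded pq] by (simp add: defs zdefs M_def)
  \<comment> \<open>\<open>Z1\<close> moves only strands up to \<open>n + p\<close> and
    \<open>k'\<close> only later ones, so \<open>k'\<close> can be moved into the prefix;
    \<open>Z3\<close> and \<open>j\<close> are separated likewise.\<close>
  have Z1K: "commuting M Z1 (?T k')" unfolding zdefs
    using le block_swap_permutes[of 0 p n] by (intro sep[OF _ pk', of _ 1 "n + p"]) (simp_all add: add.commute)
  have Z3J: "commuting M (?T j) Z3" unfolding zdefs
    using le block_swap_permutes[of p n q, unfolded pqn] by (intro sep[OF pj, of _ "p + 1" "2 * n"]) simp_all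
  have QY': "commuting M Q Y'" unfolding defs by (intro low_high low high)
  show ?thesis
  proof (rule B2_relation[where y = Y and y' = Y' and g = "P \<otimes>\<^bsub>M\<^esub> ?T k" and g' = "P' \<otimes>\<^bsub>M\<^esub> ?T k'"
      and h = "Q \<otimes>\<^bsub>M\<^esub> ?T j" and h' = "Q' \<otimes>\<^bsub>M\<^esub> ?T j'" and Z = Z
      and ?Z1.0 = Z1 and ?Z2.0 = Z2 and ?Z3.0 = Z3 and ?Z4.0 = Z4])
    show "A = Y \<otimes>\<^bsub>M\<^esub> (P' \<otimes>\<^bsub>M\<^esub> ?T k') \<otimes>\<^bsub>M\<^esub> Z1"
      using Z1K unfolding T_A A_left by (simp add: m_assoc commuting_def)
    show "A = Z4 \<otimes>\<^bsub>M\<^esub> (Y \<otimes>\<^bsub>M\<^esub> (P' \<otimes>\<^bsub>M\<^esub> ?T k'))"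
      unfolding T_A A_right by (simp add: m_assoc)
    have QY'_eq: "Q \<otimes>\<^bsub>M\<^esub> Y' = Y' \<otimes>\<^bsub>M\<^esub> Q" using QY' by (simp add: commuting_def)
    show "B = Z2 \<otimes>\<^bsub>M\<^esub> (Y' \<otimes>\<^bsub>M\<^esub> (Q \<otimes>\<^bsub>M\<^esub> ?T j))"
      unfolding T_B B_right QY'_eq by (simp add: m_assoc)
    have "B = Y' \<otimes>\<^bsub>M\<^esub> Q \<otimes>\<^bsub>M\<^esub> (Z3 \<otimes>\<^bsub>M\<^esub> ?T j)"
      unfolding T_B B_left QY'_eq by (simp add: m_assoc)
    also have "Z3 \<otimes>\<^bsub>M\<^esub> ?T j = ?T j \<otimes>\<^bsub>M\<^esub> Z3" using Z3J by (simp add: commuting_def)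
    finally show "B = Y' \<otimes>\<^bsub>M\<^esub> (Q \<otimes>\<^bsub>M\<^esub> ?T j) \<otimes>\<^bsub>M\<^esub> Z3" by (simp add: m_assoc)
    show "Z1 \<otimes>\<^bsub>M\<^esub> Z2 = Z"
      using braid_lift_block_swap_left[of 0 p q n "2 * n", unfolded add_0 pqn, unfolded pq] by (simp add: zdefs M_def x_def)
    show "Z3 \<otimes>\<^bsub>M\<^esub> Z4 = Z"
      using braid_lift_block_swap_right[of 0 n p q "2 * n", unfolded add_0 pq] le by (simp add: zdefs M_def x_def)
    have shift_mult: "Z \<otimes>\<^bsub>M\<^esub> (a \<otimes>\<^bsub>M\<^esub> b) = a' \<otimes>\<^bsub>M\<^esub> b' \<otimes>\<^bsub>M\<^esub> Z"
      if "Z \<otimes>\<^bsub>M\<^esub> a = a' \<otimes>\<^bsub>M\<^esub> Z" "Z \<otimes>\<^bsub>M\<^esub> b = b' \<otimes>\<^bsub>M\<^esub> Z"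
        and "a \<in> carrier M" "b \<in> carrier M" "a' \<in> carrier M" "b' \<in> carrier M" for a b a' b'
      using that zcarr(5) by (metis m_assoc)
    show "Z \<otimes>\<^bsub>M\<^esub> Y = Y' \<otimes>\<^bsub>M\<^esub> Z" "Z \<otimes>\<^bsub>M\<^esub> Y' = Y \<otimes>\<^bsub>M\<^esub> Z"
      unfolding defs rY' by (intro shift low)+
    show "Z \<otimes>\<^bsub>M\<^esub> (P \<otimes>\<^bsub>M\<^esub> ?T k) = P' \<otimes>\<^bsub>M\<^esub> ?T k' \<otimes>\<^bsub>M\<^esub> Z"
      "Z \<otimes>\<^bsub>M\<^esub> (P' \<otimes>\<^bsub>M\<^esub> ?T k') = P \<otimes>\<^bsub>M\<^esub> ?T k \<otimes>\<^bsub>M\<^esub> Z"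
      by (rule shift_mult; (simp; fail)?; unfold defs rP' k'_eq; intro shift low)+
    show "Z \<otimes>\<^bsub>M\<^esub> (Q \<otimes>\<^bsub>M\<^esub> ?T j) = Q' \<otimes>\<^bsub>M\<^esub> ?T j' \<otimes>\<^bsub>M\<^esub> Z"
      "Z \<otimes>\<^bsub>M\<^esub> (Q' \<otimes>\<^bsub>M\<^esub> ?T j') = Q \<otimes>\<^bsub>M\<^esub> ?T j \<otimes>\<^bsub>M\<^esub> Z"
      by (rule shift_mult; (simp; fail)?; unfold defs rQ' j'_def; intro shift low)+
    show "commuting M Y Y'" "commuting M Y (P' \<otimes>\<^bsub>M\<^esub> ?T k')" "commuting M Y (Q' \<otimes>\<^bsub>M\<^esub> ?T j')"
      unfolding defs by (intro commuting_mult low_high low high)+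
    show "commuting M Y' (P \<otimes>\<^bsub>M\<^esub> ?T k)" "commuting M Y' (Q \<otimes>\<^bsub>M\<^esub> ?T j)"
      unfolding defs by (intro commuting_mult low_high[THEN commuting_sym] low high)+
    show "commuting M (P \<otimes>\<^bsub>M\<^esub> ?T k) (P' \<otimes>\<^bsub>M\<^esub> ?T k')" "commuting M (P \<otimes>\<^bsub>M\<^esub> ?T k) (Q' \<otimes>\<^bsub>M\<^esub> ?T j')"
      "commuting M (Q \<otimes>\<^bsub>M\<^esub> ?T j) (P' \<otimes>\<^bsub>M\<^esub> ?T k')" "commuting M (Q \<otimes>\<^bsub>M\<^esub> ?T j) (Q' \<otimes>\<^bsub>M\<^esub> ?T j')"
      unfolding defs by (intro commuting_mult commuting_mult_left low_high low high)+
    \<comment> \<open>\<open>P\<close> and \<open>j\<close> live on the first cable,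
      \<open>Q\<close> and \<open>k\<close> on the second. Pairs from different cables commute by
      separation; pairs within a cable commute by \<open>PJ\<close> and \<open>QK\<close>, where the
      symmetry of the sets is used.\<close>
    have "commuting M P Q" "commuting M (?T j) (?T k)" "commuting M P (?T k)" "commuting M (?T j) Q"
      unfolding defs using le by (auto intro: sep[OF rp rp] sep[OF pj pk] sep[OF rp pk] sep[OF pj rp])
    then show "commuting M (P \<otimes>\<^bsub>M\<^esub> ?T k) (Q \<otimes>\<^bsub>M\<^esub> ?T j)"
      by (intro commuting_mult commuting_mult_left PJ QK[THEN commuting_sym]) (auto intro: commuting_sym)
    have inv: "reversal a b \<circ> reversal a b = id" for a b by (rule reversal_involution)
    show "commuting M (Y \<otimes>\<^bsub>M\<^esub> Y) (P \<otimes>\<^bsub>M\<^esub> ?T k)" "commuting M (Y \<otimes>\<^bsub>M\<^esub> Y) (Q \<otimes>\<^bsub>M\<^esub> ?T j)"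
      unfolding defs by (rule commuting_mult; rule comm_sq; (intro low inv jj kk)?; simp)+
    show "commuting M (Y' \<otimes>\<^bsub>M\<^esub> Y') (P' \<otimes>\<^bsub>M\<^esub> ?T k')" "commuting M (Y' \<otimes>\<^bsub>M\<^esub> Y') (Q' \<otimes>\<^bsub>M\<^esub> ?T j')"
      unfolding defs by (rule commuting_mult; rule comm_sq; (intro high inv jj' kk')?; simp)+
  qed simp_all
qed

theorem theorem6p11:
  fixes n k :: nat and J K :: "nat set"
  assumes "n \<ge> 2" and "k \<le> n - 2"
    and "J \<subseteq> {1..k}" and "J = (\<lambda>j. k + 1 - j) ` J"
    and "K \<subseteq> {n + k + 2..2 * n - 1}" and "K = (\<lambda>j. 3 * n + k + 1 - j) ` K"
  shows "\<exists>!\<phi>. \<phi> \<in> hom braid_monoid_B2 (braid_monoid (2 * n)) \<inter> extensional (carrier braid_monoid_B2)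
    \<and> \<phi> \<one>\<^bsub>braid_monoid_B2\<^esub> = \<one>\<^bsub>braid_monoid (2 * n)\<^esub>
    \<and> \<phi> (B2_gen 1) = braid_lift (2 * n) (longest_elt (2 * n) ({1..n + k} \<union> K))
    \<and> \<phi> (B2_gen 2) = braid_lift (2 * n) (longest_elt (2 * n) ({k + 2..2 * n - 1} \<union> J))"
proof -
  interpret monoid "braid_monoid (2 * n)" unfolding braid_monoid_def by (rule monoid_pres_monoid)
  let ?A = "braid_lift (2 * n) (longest_elt (2 * n) ({1..n + k} \<union> K))"
  let ?B = "braid_lift (2 * n) (longest_elt (2 * n) ({k + 2..2 * n - 1} \<union> J))"
  \<comment> \<open>Only the values at \<open>1\<close> and \<open>2\<close>, the two generators,
    matter.\<close>
  define f :: "nat \<Rightarrow> nat list set" where "f i = (if i = 1 then ?A else ?B)" for i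
  have sets: "{1..n + k} = {1..<n + (k + 1)}" "{k + 2..2 * n - 1} = {k + 1 + 1..<2 * n}"
    using assms(1) by auto
  have "?A \<otimes>\<^bsub>braid_monoid (2 * n)\<^esub> ?B \<otimes>\<^bsub>braid_monoid (2 * n)\<^esub> ?A \<otimes>\<^bsub>braid_monoid (2 * n)\<^esub> ?B =
    ?B \<otimes>\<^bsub>braid_monoid (2 * n)\<^esub> ?A \<otimes>\<^bsub>braid_monoid (2 * n)\<^esub> ?B \<otimes>\<^bsub>braid_monoid (2 * n)\<^esub> ?A"
    unfolding sets
  \<comment> \<open>Here \<open>p\<close> is \<open>k + 1\<close>, and \<open>k \<le> n - 2\<close>
    with \<open>n \<ge> 2\<close> ensures that the subtraction in \<open>q\<close> does not
    truncate.\<close>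
  proof (rule B2_relation_braid[where q = "n - (k + 1)"])
    show "n = k + 1 + (n - (k + 1))" "1 \<le> k + 1" using assms(1,2) by auto
    show "J \<subseteq> {1..<k + 1}" using assms(3) by auto
    show "J = (\<lambda>t. 1 + (k + 1) - 1 - t) ` J" using assms(4) by simp
    show "K \<subseteq> {n + (k + 1) + 1..<2 * n}" using assms(1,5) by fastforce
    have "n + (k + 1) + 1 + 2 * n - 1 = 3 * n + k + 1" by simp
    then show "K = (\<lambda>t. n + (k + 1) + 1 + 2 * n - 1 - t) ` K" using assms(6) by simp
  qed
  moreover have "{1..k} \<subseteq> {1..<2 * n}" "{n + k + 2..2 * n - 1} \<subseteq> {1..<2 * n}"
    using assms(1,2) by auto
  then have "J \<subseteq> {1..<2 * n}" "K \<subseteq> {1..<2 * n}"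
    using assms(3,5) by blast+
  then have c: "?A \<in> carrier (braid_monoid (2 * n))" "?B \<in> carrier (braid_monoid (2 * n))"
    using assms(1,2) by (intro braid_lift_closed longest_elt_permutes; auto)+
  ultimately have rel: "word_prod (braid_monoid (2 * n)) (map f l) = word_prod (braid_monoid (2 * n)) (map f r)"
    if "(l, r) \<in> B2_rels" for l r
    using that by (simp add: B2_rels_def word_prod_def f_def m_assoc)
  have "f ` {1, 2} \<subseteq> carrier (braid_monoid (2 * n))" using c by (simp add: f_def)
  from ex1_hom_pres_monoid[OF this rel, of B2_rels]
  show ?thesis
    by (simp add: braid_monoid_B2_def B2_gen_def f_def)
qed

end
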